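(* Let $\Omega\subset\mathbb C^m$ be a bounded domain containing the origin and $\mathcal Z=\{z\in\Omega:z_1=\cdots=z_d=0\}$. Let $\mathcal M$ be a reproducing kernel Hilbert module over $\mathcal A(\Omega)$ of $\mathbb C^r$-valued holomorphic functions on $\Omega$ containing the polynomials $\mathbb C[z_1,\dots,z_m]$, let $k\ge1$, and let $\mathcal M_q$ be the quotient module of $\mathcal M$ by the submodule of functions vanishing to order at least $k$ along $\mathcal Z$. If $\mathcal M\in\mathrm B_r(\Omega)$, then $\mathcal M_q\in\mathrm B_{|A|r}(\mathcal Z)$, where $|A|$ is the cardinality of $A=\{\alpha\in(\mathbb N\cup\{0\})^d:|\alpha|<k\}$.
   Context: $\mathcal A(\Omega)$ is the closure, in the supremum norm on $\overline\Omega$, of the functions holomorphic near $\overline\Omega$. $\mathcal M$ is a Hilbert space of holomorphic functions $\Omega\to\mathbb C^r$, with bounded evaluations, on which $\mathcal A(\Omega)$ acts norm-continuously by pointwise multiplication; containing the polynomials means containing all $\mathbb C^r$-valued polynomials. Operator class: for an open set $V\subset\mathbb C^n$, a commuting tuple $T=(T_1,\dots,T_n)$ of bounded operators on a Hilbert space $\mathcal H$ is in $\mathrm B_s(V)$ if, with $D_{T-z}h=((T_1-z_1)h,\dots,(T_n-z_n)h)\in\mathcal H^{\oplus n}$, for every $z\in V$ one has $\dim\ker D_{T-z}=s$ and $\operatorname{ran}D_{T-z}$ is closed, and the linear span of $\bigcup_{z\in V}\ker D_{T-z}$ is dense in $\mathcal H$. For a set $V$, $V^*=\{\bar z:z\in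 V\}$. Modules: $\mathcal M\in\mathrm B_r(\Omega)$ means that the tuple $(M_{z_1}^*,\dots,M_{z_m}^* )$ of adjoints of multiplications by coordinate functions on $\mathcal M$ is in the operator class $\mathrm B_r(\Omega^* )$. Assume also, as throughout the paper, that every evaluation $ev_z:\mathcal M\to\mathbb C^r$ is surjective and that the Gleason property holds: for $z\in\Omega$, $h\in\mathcal M$, $h(z)=0$ iff $h(w)=\sum_i(w_i-z_i)h^{(i)}(w)$ with $h^{(i)}\in\mathcal M$. Submodule and quotient: $\mathcal M_0=\{h\in\mathcal M:\partial_1^{\alpha_1}\cdots\partial_d^{\alpha_d}h_j|_{\mathcal Z}=0,\ \alpha\in A,\ 1\le j\le r\}$ and $\mathcal M_q=\mathcal M\ominus\mathcal M_0$ with action $f\cdot P(h)=P(fh)$, $P$ the orthogonal projection onto $\mathcal M_q$. With $1\le d<m$, $\mathcal Z$ is identified with an open subset of $\mathbb C^{m-d}$ via $(z_{d+1},\dots,z_m)$, and $\mathcal M_q\in\mathrm B_{s}(\mathcal Z)$ means that the tuple of adjoints of the compressions $PM_{z_i}|_{\mathcal M_q}$, $i=d+1,\dots,m$, is in the operator class $\mathrm B_s(\mathcal Z^* )$. *)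

theory Defs
  imports "HOL-Analysis.Analysis"
begin

text \<open>
  Complex Hilbert spaces. The norm and topology come from the class \<open>real_inner\<close>, whose inner
  product is the real part of \<open>cinner\<close>; \<open>cinner\<close> is linear in its first argument.
\<close>

class complex_hilbert = real_inner + complete_space +
  fixes scaleC :: "complex \<Rightarrow> 'a \<Rightarrow> 'a" (infixr "*\<^sub>C" 75)
    and cinner :: "'a \<Rightarrow> 'a \<Rightarrow> complex"
  assumes scaleC_add_right: "c *\<^sub>C (x + y) = c *\<^sub>C x + c *\<^sub>C y"
    and scaleC_add_left: "(b + c) *\<^sub>C x = b *\<^sub>C x + c *\<^sub>C x"
    and scaleC_scaleC: "b *\<^sub>C (c *\<^sub>C x) = (b * c) *\<^sub>C x"
    and scaleC_of_real: "complex_of_real t *\<^sub>C x = t *\<^sub>R x"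
    and cinner_commute: "cinner x y = cnj (cinner y x)"
    and cinner_add_left: "cinner (x + y) z = cinner x z + cinner y z"
    and cinner_scaleC_left: "cinner (c *\<^sub>C x) y = c * cinner x y"
    and inner_eq_Re_cinner: "inner x y = Re (cinner x y)"

global_interpretation complex_vector: vector_space "scaleC :: complex \<Rightarrow> 'a \<Rightarrow> 'a::complex_hilbert"
proof
  show "1 *\<^sub>C x = x" for x :: 'a
    using scaleC_of_real[of 1 x] by simp
qed (simp_all add: scaleC_add_right scaleC_add_left scaleC_scaleC)

definition orth_compl :: "'h::complex_hilbert set \<Rightarrow> 'h set" where
  "orth_compl S = {x. \<forall>y\<in>S. cinner x y = 0}"

text \<open>
  A Hilbert space \<open>H\<close> that is a closed subspace of the type is given by its carrier. Operators on it
  are total functions of which only the restriction to \<open>H\<close> matters.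
\<close>

definition orth_proj :: "'h::complex_hilbert set \<Rightarrow> 'h \<Rightarrow> 'h" where
  "orth_proj H x = (THE p. p \<in> H \<and> (\<forall>y\<in>H. cinner (x - p) y = 0))"

definition bounded_op_on :: "'h::complex_hilbert set \<Rightarrow> ('h \<Rightarrow> 'h) \<Rightarrow> bool" where
  "bounded_op_on H T \<longleftrightarrow>
     (\<forall>x\<in>H. T x \<in> H) \<and>
     (\<forall>x\<in>H. \<forall>y\<in>H. T (x + y) = T x + T y) \<and>
     (\<forall>c. \<forall>x\<in>H. T (c *\<^sub>C x) = c *\<^sub>C T x) \<and>
     (\<exists>K. \<forall>x\<in>H. norm (T x) \<le> K * norm x)"

definition adjoint_on :: "'h::complex_hilbert set \<Rightarrow> ('h \<Rightarrow> 'h) \<Rightarrow> 'h \<Rightarrow> 'h" where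
  "adjoint_on H T y = (THE w. w \<in> H \<and> (\<forall>x\<in>H. cinner (T x) y = cinner x w))"

text \<open>
  The operator \<open>D\<^bsub>T-z\<^esub>\<close>. The norm of the type \<open>'h ^ 'n\<close> is that of the Hilbert space direct sum.
\<close>

definition D_op :: "('n \<Rightarrow> 'h \<Rightarrow> 'h) \<Rightarrow> complex ^ 'n \<Rightarrow> 'h::complex_hilbert \<Rightarrow> 'h ^ 'n::finite" where
  "D_op T z h = (\<chi> i. T i h - (z $ i) *\<^sub>C h)"

definition D_ker :: "'h::complex_hilbert set \<Rightarrow> ('n \<Rightarrow> 'h \<Rightarrow> 'h) \<Rightarrow> complex ^ 'n::finite \<Rightarrow> 'h set" where
  "D_ker H T z = {h \<in> H. D_op T z h = 0}"

text \<open>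
  The class \<open>B\<^sub>s(V)\<close> of tuples of operators on \<open>H\<close>. The kernel condition is stated with an explicit
  finite basis because \<open>dim\<close> is \<open>0\<close> on infinite-dimensional spaces.
\<close>

definition operator_class_B ::
  "nat \<Rightarrow> (complex ^ 'n::finite) set \<Rightarrow> 'h::complex_hilbert set \<Rightarrow> ('n \<Rightarrow> 'h \<Rightarrow> 'h) \<Rightarrow> bool" where
  "operator_class_B s V H T \<longleftrightarrow>
     open V \<and>
     complex_vector.subspace H \<and> closed H \<and>
     (\<forall>i. bounded_op_on H (T i)) \<and>
     (\<forall>i j. \<forall>h\<in>H. T i (T j h) = T j (T i h)) \<and>
     (\<forall>z\<in>V. \<exists>B. finite B \<and> card B = s \<and> complex_vector.independent B \<and>
                 complex_vector.span B = D_ker H T z) \<and>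
     (\<forall>z\<in>V. closed (D_op T z ` H)) \<and>
     closure (complex_vector.span (\<Union>z\<in>V. D_ker H T z)) = H"

definition conj_set :: "(complex ^ 'n) set \<Rightarrow> (complex ^ 'n::finite) set" where
  "conj_set V = (\<lambda>z. \<chi> i. cnj (z $ i)) ` V"

definition holomorphic_several :: "(complex ^ 'n::finite \<Rightarrow> complex) \<Rightarrow> (complex ^ 'n) set \<Rightarrow> bool" where
  "holomorphic_several f U \<longleftrightarrow>
     (\<forall>z\<in>U. \<exists>D. (f has_derivative D) (at z) \<and> (\<forall>c v. D (c *s v) = c * D v))"

text \<open>
  The algebra \<open>A(\<Omega>)\<close>. Its elements are functions on \<open>closure \<Omega>\<close>; values elsewhere are arbitrary.
\<close>

definition alg_A :: "(complex ^ 'n::finite) set \<Rightarrow> (complex ^ 'n \<Rightarrow> complex) set" where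
  "alg_A \<Omega> = {f. \<forall>\<epsilon>>0. \<exists>U g. open U \<and> closure \<Omega> \<subseteq> U \<and> holomorphic_several g U \<and>
                     (\<forall>z\<in>closure \<Omega>. cmod (f z - g z) < \<epsilon>)}"

definition polynomial_several :: "(complex ^ 'n::finite \<Rightarrow> complex) \<Rightarrow> bool" where
  "polynomial_several p \<longleftrightarrow>
     (\<exists>(S :: ('n \<Rightarrow> nat) set) c. finite S \<and>
        p = (\<lambda>z. \<Sum>\<alpha>\<in>S. c \<alpha> * (\<Prod>i\<in>UNIV. (z $ i) ^ \<alpha> i)))"

text \<open>
  A Hilbert space of functions on \<open>\<Omega>\<close> is a Hilbert space type \<open>'h\<close> together with a linear map \<open>ev\<close>
  sending \<open>h\<close> to the function it is; the values of \<open>ev h\<close> outside \<open>\<Omega>\<close> carry no meaning, and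
  \<open>h\<close> is determined by the values on \<open>\<Omega>\<close>. The product \<open>f h\<close> is the element with values
  \<open>f(z) h(z)\<close> on \<open>\<Omega>\<close>.
\<close>

definition module_mult ::
  "(complex ^ 'n) set \<Rightarrow> ('h \<Rightarrow> complex ^ 'n \<Rightarrow> complex ^ 'r) \<Rightarrow>
   (complex ^ 'n::finite \<Rightarrow> complex) \<Rightarrow> 'h::complex_hilbert \<Rightarrow> 'h" where
  "module_mult \<Omega> ev f h = (THE g. \<forall>z\<in>\<Omega>. ev g z = f z *s ev h z)"

definition coord_mult ::
  "(complex ^ 'n) set \<Rightarrow> ('h \<Rightarrow> complex ^ 'n \<Rightarrow> complex ^ 'r) \<Rightarrow>
   'n::finite \<Rightarrow> 'h::complex_hilbert \<Rightarrow> 'h" where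
  "coord_mult \<Omega> ev i = module_mult \<Omega> ev (\<lambda>z. z $ i)"

definition rk_hilbert_module ::
  "(complex ^ 'n::finite) set \<Rightarrow> ('h::complex_hilbert \<Rightarrow> complex ^ 'n \<Rightarrow> complex ^ 'r::finite) \<Rightarrow> bool" where
  "rk_hilbert_module \<Omega> ev \<longleftrightarrow>
     (\<forall>g h. (\<forall>z\<in>\<Omega>. ev g z = ev h z) \<longrightarrow> g = h) \<and>
     (\<forall>z\<in>\<Omega>. bounded_linear (\<lambda>h. ev h z) \<and> (\<forall>c h. ev (c *\<^sub>C h) z = c *s ev h z)) \<and>
     (\<forall>h j. holomorphic_several (\<lambda>z. ev h z $ j) \<Omega>) \<and>
     (\<forall>f\<in>alg_A \<Omega>. \<forall>h. \<exists>g. \<forall>z\<in>\<Omega>. ev g z = f z *s ev h z) \<and>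
     (\<forall>f\<in>alg_A \<Omega>. \<forall>h. \<forall>\<epsilon>>0. \<exists>\<delta>>0. \<forall>f'\<in>alg_A \<Omega>. \<forall>h'.
        (\<forall>z\<in>closure \<Omega>. cmod (f' z - f z) < \<delta>) \<and> norm (h' - h) < \<delta> \<longrightarrow>
        norm (module_mult \<Omega> ev f' h' - module_mult \<Omega> ev f h) < \<epsilon>)"

definition contains_polynomials ::
  "(complex ^ 'n::finite) set \<Rightarrow> ('h::complex_hilbert \<Rightarrow> complex ^ 'n \<Rightarrow> complex ^ 'r::finite) \<Rightarrow> bool" where
  "contains_polynomials \<Omega> ev \<longleftrightarrow>
     (\<forall>p :: complex ^ 'n \<Rightarrow> complex ^ 'r.
        (\<forall>j. polynomial_several (\<lambda>z. p z $ j)) \<longrightarrow> (\<exists>h. \<forall>z\<in>\<Omega>. ev h z = p z))"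

definition gleason_property ::
  "(complex ^ 'n::finite) set \<Rightarrow> ('h::complex_hilbert \<Rightarrow> complex ^ 'n \<Rightarrow> complex ^ 'r::finite) \<Rightarrow> bool" where
  "gleason_property \<Omega> ev \<longleftrightarrow>
     (\<forall>z\<in>\<Omega>. \<forall>h. ev h z = 0 \<longleftrightarrow>
        (\<exists>u :: 'n \<Rightarrow> 'h. \<forall>w\<in>\<Omega>. ev h w = (\<Sum>i\<in>UNIV. (w $ i - z $ i) *s ev (u i) w)))"

definition module_in_B ::
  "nat \<Rightarrow> (complex ^ 'n::finite) set \<Rightarrow> ('h::complex_hilbert \<Rightarrow> complex ^ 'n \<Rightarrow> complex ^ 'r::finite) \<Rightarrow> bool" where
  "module_in_B s \<Omega> ev \<longleftrightarrow>
     operator_class_B s (conj_set \<Omega>) UNIV (\<lambda>i. adjoint_on UNIV (coord_mult \<Omega> ev i))"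

text \<open>
  The coordinates are indexed by a sum type: \<open>Inl\<close> for \<open>z\<^sub>1, \<dots>, z\<^sub>d\<close>, \<open>Inr\<close> for the remaining
  \<open>m - d\<close> ones. Thus \<open>d = CARD('d)\<close>, \<open>m = CARD('d) + CARD('e)\<close>, and \<open>1 \<le> d < m\<close> since types are
  nonempty. The order on \<open>'d\<close> fixes the order of the partial derivatives.
\<close>

definition Z_set :: "(complex ^ ('d::finite + 'e::finite)) set \<Rightarrow> (complex ^ ('d + 'e)) set" where
  "Z_set \<Omega> = {z \<in> \<Omega>. \<forall>i. z $ Inl i = 0}"

definition Z_coords :: "(complex ^ ('d::finite + 'e::finite)) set \<Rightarrow> (complex ^ 'e) set" where
  "Z_coords \<Omega> = (\<lambda>z. \<chi> j. z $ Inr j) ` Z_set \<Omega>"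

definition cpartial :: "'n::finite \<Rightarrow> (complex ^ 'n \<Rightarrow> complex) \<Rightarrow> complex ^ 'n \<Rightarrow> complex" where
  "cpartial i f z = deriv (\<lambda>t. f (z + t *s axis i 1)) 0"

definition multi_partial ::
  "('d \<Rightarrow> nat) \<Rightarrow> (complex ^ ('d::{finite,linorder} + 'e::finite) \<Rightarrow> complex) \<Rightarrow>
   complex ^ ('d + 'e) \<Rightarrow> complex" where
  "multi_partial \<alpha> f = foldr (\<lambda>i. cpartial (Inl i) ^^ \<alpha> i) (sorted_list_of_set UNIV) f"

definition A_indices :: "nat \<Rightarrow> ('d::finite \<Rightarrow> nat) set" where
  "A_indices k = {\<alpha>. (\<Sum>i\<in>UNIV. \<alpha> i) < k}"

definition submodule_M0 ::
  "(complex ^ ('d::{finite,linorder} + 'e::finite)) set \<Rightarrow> nat \<Rightarrow>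
   ('h::complex_hilbert \<Rightarrow> complex ^ ('d + 'e) \<Rightarrow> complex ^ 'r::finite) \<Rightarrow> 'h set" where
  "submodule_M0 \<Omega> k ev =
     {h. \<forall>\<alpha>\<in>A_indices k. \<forall>j. \<forall>z\<in>Z_set \<Omega>. multi_partial \<alpha> (\<lambda>w. ev h w $ j) z = 0}"

definition quotient_Mq ::
  "(complex ^ ('d::{finite,linorder} + 'e::finite)) set \<Rightarrow> nat \<Rightarrow>
   ('h::complex_hilbert \<Rightarrow> complex ^ ('d + 'e) \<Rightarrow> complex ^ 'r::finite) \<Rightarrow> 'h set" where
  "quotient_Mq \<Omega> k ev = orth_compl (submodule_M0 \<Omega> k ev)"

definition quotient_in_B ::
  "nat \<Rightarrow> (complex ^ ('d::{finite,linorder} + 'e::finite)) set \<Rightarrow> nat \<Rightarrow>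
   ('h::complex_hilbert \<Rightarrow> complex ^ ('d + 'e) \<Rightarrow> complex ^ 'r::finite) \<Rightarrow> bool" where
  "quotient_in_B s \<Omega> k ev \<longleftrightarrow>
     operator_class_B s (conj_set (Z_coords \<Omega>)) (quotient_Mq \<Omega> k ev)
       (\<lambda>j. adjoint_on (quotient_Mq \<Omega> k ev)
              (\<lambda>h. orth_proj (quotient_Mq \<Omega> k ev) (coord_mult \<Omega> ev (Inr j) h)))"

end

theory Submission imports Defs "HOL-Complex_Analysis.Cauchy_Integral_Formula" begin

text \<open>Let \<open>L w\<close> be the space of all \<open>h\<close> in the module whose normal derivatives of order below \<open>k\<close> vanish
  at the point \<open>(0, w)\<close> of the subvariety. The submodule is the intersection of the \<open>L w\<close>, and it is
  invariant under the tangential multiplications \<open>M\<^sub>l\<close>. Therefore the adjoints of the compressions to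
  the quotient are the restrictions of the adjoints \<open>M\<^sub>l\<^sup>*\<close>, and their joint eigenspace at the
  conjugate of \<open>w\<close> is the orthogonal complement of (submodule) \<open>+ \<Sum>\<^sub>l ran (M\<^sub>l - w\<^sub>l)\<close>.

  The algebraic heart of the proof is that this sum equals \<open>L w\<close>
  (\<open>vanishing_jet_decomposition\<close>). Iterating the Gleason property writes every \<open>h\<close> as a polynomial of
  degree below \<open>k\<close> in the normal coordinates, plus an element of the submodule, plus a tangential
  term (\<open>Taylor_decomposition\<close>). The polynomial part is determined by the jet of \<open>h\<close>, since normal
  monomials are biorthogonal, up to factorials, to the derivatives.

  Everything else is functional analysis (\<open>quotient_tuple_in_class_B\<close>). Each derivative at a point is a
  bounded functional, by Banach and Steinhaus, so \<open>L w\<close> is closed and \<open>(L w)\<^sup>\<bottom>\<close> has as a basis the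
  Riesz representatives of the \<open>\<bar>A\<bar> r\<close> derivative functionals. The range is closed because, for \<open>y\<close> in
  the quotient, the pairing of \<open>y\<close> with a vector of \<open>L w\<close> is controlled by the joint operator applied to
  \<open>y\<close>; uniform boundedness turns this into a lower bound for the joint operator. The eigenspaces are
  total because a vector orthogonal to all of them lies in every \<open>L w\<close>, hence in the submodule.

  The complex analysis needed is elementary: holomorphic functions are treated as continuous functions
  that are holomorphic on complex lines, a class closed under partial derivatives
  (\<open>hol_on_lines_cpartial\<close>), and Leibniz' rule for multiplication by a coordinate is
  applied one direction at a time.\<close>

section \<open>Complex Hilbert spaces\<close>

lemma cinner_add_right: "cinner x (y + z) = cinner x y + cinner x (z::'h::complex_hilbert)"
  using cinner_commute[of x "y + z"] cinner_commute[of x y] cinner_commute[of x z]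
  by (simp add: cinner_add_left)

lemma cinner_scaleC_right: "cinner x (c *\<^sub>C y) = cnj c * cinner x (y::'h::complex_hilbert)"
  using cinner_commute[of x "c *\<^sub>C y"] cinner_commute[of x y] by (simp add: cinner_scaleC_left)

lemma cinner_zero_left [simp]: "cinner 0 (y::'h::complex_hilbert) = 0"
  using cinner_add_left[of 0 0 y] by simp

lemma cinner_zero_right [simp]: "cinner (y::'h::complex_hilbert) 0 = 0"
  using cinner_add_right[of y 0 0] by simp

lemma cinner_minus_left: "cinner (- x) (y::'h::complex_hilbert) = - cinner x y"
  using cinner_add_left[of x "-x" y] by (simp add: add_eq_0_iff)

lemma cinner_minus_right: "cinner x (- y) = - cinner x (y::'h::complex_hilbert)"
  using cinner_add_right[of x y "-y"] by (simp add: add_eq_0_iff)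

lemma cinner_diff_left: "cinner (x - z) (y::'h::complex_hilbert) = cinner x y - cinner z y"
  using cinner_add_left[of x "-z" y] by (simp add: cinner_minus_left)

lemma cinner_diff_right: "cinner x (y - z) = cinner x y - cinner x (z::'h::complex_hilbert)"
  using cinner_add_right[of x y "-z"] by (simp add: cinner_minus_right)

lemma cinner_sum_left: "cinner (\<Sum>i\<in>I. f i) (y::'h::complex_hilbert) = (\<Sum>i\<in>I. cinner (f i) y)"
  by (induction I rule: infinite_finite_induct) (auto simp: cinner_add_left)

lemma cinner_sum_right: "cinner (y::'h::complex_hilbert) (\<Sum>i\<in>I. f i) = (\<Sum>i\<in>I. cinner y (f i))"
  by (induction I rule: infinite_finite_induct) (auto simp: cinner_add_right)

lemma cinner_self: "cinner x x = of_real ((norm (x::'h::complex_hilbert))\<^sup>2)"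
proof -
  have "Im (cinner x x) = 0"
    using arg_cong[OF cinner_commute[of x x], of Im] by simp
  moreover have "Re (cinner x x) = (norm x)\<^sup>2"
    by (simp add: power2_norm_eq_inner inner_eq_Re_cinner)
  ultimately show ?thesis by (simp add: complex_eq_iff)
qed

lemma cinner_self_eq_0_iff [simp]: "cinner x x = 0 \<longleftrightarrow> (x::'h::complex_hilbert) = 0"
  by (simp add: cinner_self)

lemma norm_scaleC: "norm (c *\<^sub>C x) = cmod c * norm (x::'h::complex_hilbert)"
proof -
  have "complex_of_real ((norm (c *\<^sub>C x))\<^sup>2) = c * cnj c * of_real ((norm x)\<^sup>2)"
    by (simp add: cinner_self[symmetric] cinner_scaleC_left cinner_scaleC_right mult_ac del: of_real_power)
  also have "c * cnj c = of_real ((cmod c)\<^sup>2)"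
    by (rule complex_norm_square[symmetric])
  finally have "(norm (c *\<^sub>C x))\<^sup>2 = (cmod c * norm x)\<^sup>2"
    by (simp only: of_real_mult[symmetric] of_real_eq_iff power_mult_distrib)
  then show ?thesis by (simp add: power2_eq_iff_nonneg)
qed

text \<open>Rotating the first argument by a phase makes the complex pairing real, which reduces the
  complex inequality to the real one.\<close>
lemma cinner_Cauchy_Schwarz: "cmod (cinner x y) \<le> norm x * norm (y::'h::complex_hilbert)"
proof (cases "cinner x y = 0")
  case False
  define c where "c = cnj (sgn (cinner x y))"
  have c: "cmod c = 1" using False by (simp add: c_def norm_sgn)
  have "c * cinner x y = of_real (cmod (cinner x y))"
    using False unfolding c_def sgn_eq
    by (simp add: mult.commute[of "cnj _"] complex_norm_square[symmetric] power2_eq_square)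
  then have "cmod (cinner x y) = inner (c *\<^sub>C x) y"
    by (simp add: inner_eq_Re_cinner cinner_scaleC_left)
  also have "\<dots> \<le> norm (c *\<^sub>C x) * norm y" by (rule norm_cauchy_schwarz)
  finally show ?thesis by (simp add: norm_scaleC c)
qed simp

lemma bounded_linear_cinner_left: "bounded_linear (\<lambda>x. cinner x (y::'h::complex_hilbert))"
proof (rule bounded_linear_intro[where K = "norm y"])
  show "cinner (r *\<^sub>R x) y = r *\<^sub>R cinner x y" for r x
    by (simp add: scaleC_of_real[symmetric] cinner_scaleC_left scaleR_conv_of_real)
qed (auto simp: cinner_add_left cinner_Cauchy_Schwarz)

lemma bounded_linear_scaleC_right: "bounded_linear (\<lambda>x::'h::complex_hilbert. c *\<^sub>C x)"
proof (rule bounded_linear_intro[where K = "cmod c"])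
  show "c *\<^sub>C (r *\<^sub>R x) = r *\<^sub>R c *\<^sub>C x" for r and x :: 'h
    by (simp add: scaleC_of_real[symmetric] scaleC_scaleC mult.commute)
qed (auto simp: scaleC_add_right norm_scaleC mult.commute)

lemma complex_subspace_imp_real_subspace:
  assumes "complex_vector.subspace (S::'h::complex_hilbert set)"
  shows "subspace S"
  unfolding subspace_def
  using complex_vector.subspace_0[OF assms] complex_vector.subspace_add[OF assms]
    complex_vector.subspace_scale[OF assms, of _ "complex_of_real _"]
  by (auto simp: scaleC_of_real)

lemma cinner_eq_iff: "(\<forall>x. cinner x y = cinner x z) \<longleftrightarrow> y = (z::'h::complex_hilbert)"
proof
  assume "\<forall>x. cinner x y = cinner x z"
  then have "cinner (y - z) (y - z) = 0" by (simp add: cinner_diff_right)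
  then show "y = z" by simp
qed auto

lemma subspace_orth_compl: "complex_vector.subspace (orth_compl S)"
  by (auto simp: complex_vector.subspace_def orth_compl_def cinner_add_left cinner_scaleC_left)

lemma closed_orth_compl: "closed (orth_compl (S::'h::complex_hilbert set))"
proof -
  have "orth_compl S = (\<Inter>y\<in>S. {x. cinner x y = 0})" by (auto simp: orth_compl_def)
  moreover have "closed {x. cinner x y = 0}" for y :: 'h
    by (intro closed_Collect_eq continuous_intros
        linear_continuous_on[OF bounded_linear_cinner_left])
  ultimately show ?thesis by auto
qed

text \<open>The projection theorem: a minimising sequence for the distance to \<open>S\<close> is Cauchy by the
  parallelogram law, and first-order minimality of its limit is orthogonality.\<close>
lemma orthogonal_projection_exists:
  fixes x :: "'h::complex_hilbert"
  assumes S: "complex_vector.subspace S" and cl: "closed S"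
  shows "\<exists>p\<in>S. \<forall>y\<in>S. cinner (x - p) y = 0"
proof -
  define d where "d = infdist x S"
  have ne: "S \<noteq> {}" using complex_vector.subspace_0[OF S] by auto
  have sub: "subspace S" by (rule complex_subspace_imp_real_subspace[OF S])
  have d0: "d \<ge> 0" by (simp add: d_def infdist_nonneg)
  have dle: "d \<le> norm (x - y)" if "y \<in> S" for y
    using infdist_le[OF that, of x] by (simp add: d_def dist_norm)
  have "\<exists>y\<in>S. norm (x - y) < d + 1 / real (Suc n)" for n
  proof -
    have "(INF y\<in>S. dist x y) < d + 1 / real (Suc n)"
      using ne by (simp add: d_def infdist_def)
    then obtain y where "y \<in> S" "dist x y < d + 1 / real (Suc n)"
      using ne by (subst (asm) cINF_less_iff) auto
    then show ?thesis by (auto simp: dist_norm)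
  qed
  then obtain y where y: "\<And>n. y n \<in> S" "\<And>n. norm (x - y n) < d + 1 / real (Suc n)"
    by metis
  have para: "(norm (y n - y m))\<^sup>2 \<le> 2 * (norm (x - y n))\<^sup>2 + 2 * (norm (x - y m))\<^sup>2 - 4 * d\<^sup>2"
    for n m
  proof -
    have mid: "(1/2) *\<^sub>R (y n + y m) \<in> S"
      using sub y by (simp add: subspace_add subspace_scale)
    have "d\<^sup>2 \<le> (norm (x - (1/2) *\<^sub>R (y n + y m)))\<^sup>2"
      using dle[OF mid] d0 by (rule power_mono)
    moreover have "(norm (y n - y m))\<^sup>2 + 4 * (norm (x - (1/2) *\<^sub>R (y n + y m)))\<^sup>2
        = 2 * (norm (x - y n))\<^sup>2 + 2 * (norm (x - y m))\<^sup>2"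
      by (simp add: power2_norm_eq_inner inner_diff_left inner_diff_right inner_add_left
          inner_add_right inner_commute algebra_simps)
    ultimately show ?thesis by linarith
  qed
  have lim: "(\<lambda>n. norm (x - y n)) \<longlonglongrightarrow> d"
  proof (rule tendsto_sandwich[of "\<lambda>n. d" _ _ "\<lambda>n. d + 1 / real (Suc n)"])
    show "(\<lambda>n. d + 1 / real (Suc n)) \<longlonglongrightarrow> d"
      using tendsto_add[OF tendsto_const[of d] LIMSEQ_inverse_real_of_nat]
      by (simp add: inverse_eq_divide)
  qed (use y dle in \<open>auto intro!: always_eventually less_imp_le\<close>)
  have "Cauchy y"
  proof (rule metric_CauchyI)
    fix e :: real assume e: "e > 0"
    have "(\<lambda>n. 2 * (norm (x - y n))\<^sup>2) \<longlonglongrightarrow> 2 * d\<^sup>2" by (intro tendsto_intros lim)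
    then have "\<forall>\<^sub>F n in sequentially. 2 * (norm (x - y n))\<^sup>2 < 2 * d\<^sup>2 + e\<^sup>2 / 2"
      using e by (intro order_tendstoD(2)[where y = "2 * d\<^sup>2"]) auto
    then obtain N where N: "\<And>n. n \<ge> N \<Longrightarrow> 2 * (norm (x - y n))\<^sup>2 < 2 * d\<^sup>2 + e\<^sup>2 / 2"
      by (auto simp: eventually_sequentially)
    have "dist (y m) (y n) < e" if "m \<ge> N" "n \<ge> N" for m n
    proof -
      have "(norm (y m - y n))\<^sup>2 < e\<^sup>2"
        using para[of m n] N[OF that(1)] N[OF that(2)] by linarith
      then show ?thesis using e by (simp add: dist_norm power2_less_imp_less)
    qed
    then show "\<exists>M. \<forall>m\<ge>M. \<forall>n\<ge>M. dist (y m) (y n) < e" by blast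
  qed
  then obtain p where p: "y \<longlonglongrightarrow> p" using Cauchy_convergent convergent_def by blast
  have pS: "p \<in> S" using closed_sequentially[OF cl] y(1) p by blast
  have "(\<lambda>n. norm (x - y n)) \<longlonglongrightarrow> norm (x - p)" by (intro tendsto_intros p)
  then have dp: "norm (x - p) = d" using lim LIMSEQ_unique by blast
  have orth: "inner (x - p) v = 0" if v: "v \<in> S" for v
  proof (cases "v = 0")
    case False
    define t where "t = inner (x - p) v / (norm v)\<^sup>2"
    have "p + t *\<^sub>R v \<in> S" using sub pS v by (simp add: subspace_add subspace_scale)
    then have "d\<^sup>2 \<le> (norm (x - (p + t *\<^sub>R v)))\<^sup>2" using dle d0 by (intro power_mono) auto
    also have "\<dots> = (norm (x - p))\<^sup>2 - 2 * t * inner (x - p) v + t\<^sup>2 * (norm v)\<^sup>2"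
      unfolding power2_norm_eq_inner
      by (simp add: inner_diff_left inner_diff_right inner_add_left inner_add_right
          inner_commute algebra_simps power2_eq_square)
    also have "\<dots> = d\<^sup>2 - (inner (x - p) v)\<^sup>2 / (norm v)\<^sup>2"
      using False by (simp add: t_def dp field_simps power2_eq_square)
    finally have "(inner (x - p) v)\<^sup>2 / (norm v)\<^sup>2 \<le> 0" by simp
    then show ?thesis using False by (simp add: divide_le_0_iff)
  qed simp
  have "cinner (x - p) v = 0" if v: "v \<in> S" for v
  proof -
    have "Re (cinner (x - p) v) = 0" using orth[OF v] by (simp add: inner_eq_Re_cinner)
    moreover have "\<i> *\<^sub>C v \<in> S" by (rule complex_vector.subspace_scale[OF S v])
    then have "Re (cinner (x - p) (\<i> *\<^sub>C v)) = 0" using orth by (simp add: inner_eq_Re_cinner)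
    ultimately show ?thesis by (simp add: cinner_scaleC_right complex_eq_iff)
  qed
  then show ?thesis using pS by blast
qed

text \<open>Uniqueness of the projection, which is what makes the definite description in
  \<open>orth_proj\<close> denote.\<close>
lemma orth_proj_eqI:
  fixes x :: "'h::complex_hilbert"
  assumes S: "complex_vector.subspace S" and "p \<in> S" "\<And>y. y \<in> S \<Longrightarrow> cinner (x - p) y = 0"
  shows "orth_proj S x = p"
  unfolding orth_proj_def
proof (rule the_equality)
  fix q assume q: "q \<in> S \<and> (\<forall>y\<in>S. cinner (x - q) y = 0)"
  have "q - p \<in> S" using q assms complex_vector.subspace_diff by blast
  then have "cinner (x - p) (q - p) = 0" "cinner (x - q) (q - p) = 0"
    using q assms by auto
  then have "cinner (q - p) (q - p) = 0"
    by (simp add: cinner_diff_left)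
  then show "q = p" by simp
qed (use assms in auto)

lemma
  fixes S :: "'h::complex_hilbert set"
  assumes S: "complex_vector.subspace S" and cl: "closed S"
  shows orth_proj_mem: "orth_proj S x \<in> S"
    and orth_proj_orth: "y \<in> S \<Longrightarrow> cinner (x - orth_proj S x) y = 0"
    and orth_proj_cinner: "y \<in> S \<Longrightarrow> cinner (orth_proj S x) y = cinner x y"
proof -
  obtain p where p: "p \<in> S" "\<And>y. y \<in> S \<Longrightarrow> cinner (x - p) y = 0"
    using orthogonal_projection_exists[OF S cl] by metis
  have "orth_proj S x = p" by (rule orth_proj_eqI[OF S p])
  then show "orth_proj S x \<in> S" "y \<in> S \<Longrightarrow> cinner (x - orth_proj S x) y = 0"
    using p by auto
  then show "y \<in> S \<Longrightarrow> cinner (orth_proj S x) y = cinner x y" by (simp add: cinner_diff_left)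
qed

lemma orth_compl_orth_compl:
  fixes S :: "'h::complex_hilbert set"
  assumes S: "complex_vector.subspace S" and cl: "closed S"
  shows "orth_compl (orth_compl S) = S"
proof
  show "S \<subseteq> orth_compl (orth_compl S)"
  proof
    fix x assume "x \<in> S"
    then show "x \<in> orth_compl (orth_compl S)"
      using cinner_commute[of x] by (auto simp: orth_compl_def)
  qed
  show "orth_compl (orth_compl S) \<subseteq> S"
  proof
    fix x assume x: "x \<in> orth_compl (orth_compl S)"
    let ?p = "orth_proj S x"
    have "x - ?p \<in> orth_compl S"
      using orth_proj_orth[OF S cl] by (auto simp: orth_compl_def)
    then have "cinner x (x - ?p) = 0" "cinner (x - ?p) ?p = 0"
      using x orth_proj_mem[OF S cl] by (auto simp: orth_compl_def)
    then have "cinner (x - ?p) (x - ?p) = 0"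
      using cinner_commute[of ?p "x - ?p"] by (simp add: cinner_diff_left[of x])
    then show "x \<in> S" using orth_proj_mem[OF S cl, of x] by simp
  qed
qed

lemma closure_complex_subspace:
  fixes S :: "'h::complex_hilbert set"
  assumes S: "complex_vector.subspace S"
  shows "complex_vector.subspace (closure S)"
  unfolding complex_vector.subspace_def
proof (intro conjI ballI allI)
  show "0 \<in> closure S" using S complex_vector.subspace_0 closure_subset by blast
next
  fix x y assume "x \<in> closure S" "y \<in> closure S"
  then obtain f g where fg: "\<And>n. f n \<in> S" "f \<longlonglongrightarrow> x" "\<And>n. g n \<in> S" "g \<longlonglongrightarrow> y"
    unfolding closure_sequential by blast
  have "f n + g n \<in> S" for n using fg by (intro complex_vector.subspace_add[OF S])
  then show "x + y \<in> closure S"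
    unfolding closure_sequential using tendsto_add[OF fg(2) fg(4)]
    by (intro exI[of _ "\<lambda>n. f n + g n"]) auto
next
  fix c x assume "x \<in> closure S"
  moreover have "(\<lambda>x. c *\<^sub>C x) ` closure S \<subseteq> closure ((\<lambda>x. c *\<^sub>C x) ` S)"
    by (rule closure_bounded_linear_image_subset[OF bounded_linear_scaleC_right])
  moreover have "(\<lambda>x. c *\<^sub>C x) ` S \<subseteq> S" using S complex_vector.subspace_scale by blast
  ultimately show "c *\<^sub>C x \<in> closure S" using closure_mono by blast
qed

text \<open>The Riesz representation: a functional \<open>\<phi> \<noteq> 0\<close> is a multiple of the pairing with a
  vector orthogonal to its kernel.\<close>
lemma Riesz_representation:
  fixes \<phi> :: "'h::complex_hilbert \<Rightarrow> complex"
  assumes bl: "bounded_linear \<phi>" and hom: "\<And>c x. \<phi> (c *\<^sub>C x) = c * \<phi> x"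
  shows "\<exists>k. \<forall>x. \<phi> x = cinner x k"
proof (cases "\<forall>x. \<phi> x = 0")
  case True
  then show ?thesis by (intro exI[of _ 0]) simp
next
  case False
  then obtain a where a: "\<phi> a \<noteq> 0" by blast
  interpret \<phi>: bounded_linear \<phi> by (rule bl)
  let ?K = "{x. \<phi> x = 0}"
  have K: "complex_vector.subspace ?K"
    by (auto simp: complex_vector.subspace_def hom \<phi>.add \<phi>.zero)
  have cl: "closed ?K"
    by (intro closed_Collect_eq continuous_intros linear_continuous_on[OF bl])
  obtain p where p: "\<phi> p = 0" "\<And>y. \<phi> y = 0 \<Longrightarrow> cinner (a - p) y = 0"
    using orthogonal_projection_exists[OF K cl, of a] by auto
  let ?b = "a - p"
  have b: "\<phi> ?b = \<phi> a" by (simp add: \<phi>.diff p)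
  then have b0: "?b \<noteq> 0" using a \<phi>.zero by metis
  have "\<phi> x = cinner x ((cnj (\<phi> a) / of_real ((norm ?b)\<^sup>2)) *\<^sub>C ?b)" for x
  proof -
    have "\<phi> (x - (\<phi> x / \<phi> a) *\<^sub>C ?b) = 0" using a by (simp add: \<phi>.diff hom b[simplified \<phi>.diff])
    then have "cinner (x - (\<phi> x / \<phi> a) *\<^sub>C ?b) ?b = 0"
      using p(2)[of "x - (\<phi> x / \<phi> a) *\<^sub>C ?b"] cinner_commute[of _ ?b] by simp
    then have "cinner x ?b = (\<phi> x / \<phi> a) * of_real ((norm ?b)\<^sup>2)"
      by (simp only: cinner_diff_left cinner_scaleC_left cinner_self) simp
    then show ?thesis using a b0 by (simp add: cinner_scaleC_right)
  qed
  then show ?thesis by blast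
qed

text \<open>Riesz applied to \<open>x \<mapsto> \<langle>T x, y\<rangle>\<close>. The adjoint is needed as a total map, because the adjoint of
  a compression is later identified with a restriction of it.\<close>
lemma ex_adjoint:
  fixes T :: "'h::complex_hilbert \<Rightarrow> 'h"
  assumes bl: "bounded_linear T" and hom: "\<And>c x. T (c *\<^sub>C x) = c *\<^sub>C T x"
  shows "\<exists>S. bounded_linear S \<and> (\<forall>c x. S (c *\<^sub>C x) = c *\<^sub>C S x) \<and>
             (\<forall>x y. cinner (T x) y = cinner x (S y))"
proof -
  interpret T: bounded_linear T by (rule bl)
  have "\<exists>k. \<forall>x. cinner (T x) y = cinner x k" for y
    by (rule Riesz_representation)
      (auto simp: hom cinner_scaleC_left intro: bounded_linear_compose[OF bounded_linear_cinner_left bl])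
  then obtain S where S: "\<And>x y. cinner (T x) y = cinner x (S y)" by metis
  obtain K where K: "\<And>x. norm (T x) \<le> norm x * K" "K > 0" using T.pos_bounded by blast
  have add: "S (x + y) = S x + S y" for x y
    by (subst cinner_eq_iff[symmetric]) (simp add: S[symmetric] cinner_add_right)
  have scale: "S (c *\<^sub>C x) = c *\<^sub>C S x" for c x
    by (subst cinner_eq_iff[symmetric]) (simp add: S[symmetric] cinner_scaleC_right)
  have "norm (S y) \<le> norm y * K" for y
  proof -
    have "(norm (S y))\<^sup>2 = cmod (cinner (T (S y)) y)"
      unfolding S cinner_self by (simp add: norm_power)
    also have "\<dots> \<le> norm (T (S y)) * norm y" by (rule cinner_Cauchy_Schwarz)
    also have "\<dots> \<le> norm (S y) * K * norm y" by (intro mult_right_mono K) auto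
    finally have "norm (S y) * norm (S y) \<le> norm (S y) * (norm y * K)"
      by (simp add: power2_eq_square mult_ac)
    then show ?thesis
      using K(2) by (cases "norm (S y) = 0") (auto simp: mult_le_cancel_left)
  qed
  then have "bounded_linear S"
    by (intro bounded_linear_intro[where K = K]) (auto simp: add scale simp flip: scaleC_of_real)
  then show ?thesis using S scale by blast
qed

section \<open>Uniform boundedness\<close>

text \<open>By Baire, one of the closed sets on which the family is bounded by \<open>n\<close> contains a ball, and
  linearity transports the bound from that ball to the unit ball.\<close>
lemma uniform_boundedness_principle:
  fixes F :: "'i \<Rightarrow> 'a::{real_normed_vector, complete_space} \<Rightarrow> 'b::real_normed_vector"
  assumes bl: "\<And>i. i \<in> I \<Longrightarrow> bounded_linear (F i)"
    and ptw: "\<And>x. \<exists>B. \<forall>i\<in>I. norm (F i x) \<le> B"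
  shows "\<exists>K. \<forall>i\<in>I. \<forall>x. norm (F i x) \<le> K * norm x"
proof -
  define C where "C n = {x. \<forall>i\<in>I. norm (F i x) \<le> real n}" for n :: nat
  have clC: "closed (C n)" for n
  proof -
    have "C n = (\<Inter>i\<in>I. {x. norm (F i x) \<le> real n})" by (auto simp: C_def)
    moreover have "closed {x. norm (F i x) \<le> real n}" if "i \<in> I" for i
      by (intro closed_Collect_le continuous_intros linear_continuous_on[OF bl[OF that]])
    ultimately show ?thesis by auto
  qed
  have UC: "(\<Union>n. C n) = UNIV"
  proof -
    have "\<exists>n. x \<in> C n" for x
    proof -
      obtain B where "\<forall>i\<in>I. norm (F i x) \<le> B" using ptw by blast
      moreover obtain n where "B \<le> real n" using real_arch_simple by blast
      ultimately have "x \<in> C n" by (fastforce simp: C_def)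
      then show ?thesis ..
    qed
    then show ?thesis by auto
  qed
  have "\<exists>n. interior (C n) \<noteq> {}"
  proof (rule ccontr)
    assume "\<nexists>n. interior (C n) \<noteq> {}"
    then have "euclidean interior_of \<Union>(range C) = {}"
      by (intro Baire_category_alt) (auto simp: clC completely_metrizable_space_euclidean)
    then show False using UC by simp
  qed
  then obtain n a where "a \<in> interior (C n)" by blast
  then obtain e where e: "e > 0" "cball a e \<subseteq> C n" by (meson mem_interior_cball)
  have "norm (F i x) \<le> (2 * real n / e) * norm x" if i: "i \<in> I" for i x
  proof (cases "x = 0")
    case True
    then show ?thesis using linear_0[OF bounded_linear.linear[OF bl[OF i]]] by simp
  next
    case False
    interpret bounded_linear "F i" by (rule bl[OF i])
    let ?s = "e / norm x"
    have "a + ?s *\<^sub>R x \<in> cball a e" "a \<in> cball a e"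
      using False e by (auto simp: dist_norm)
    then have "norm (F i (a + ?s *\<^sub>R x)) \<le> real n" "norm (F i a) \<le> real n"
      using e(2) i by (fastforce simp: C_def)+
    then have "norm (F i (a + ?s *\<^sub>R x) - F i a) \<le> 2 * real n"
      using norm_triangle_ineq4[of "F i (a + ?s *\<^sub>R x)" "F i a"] by linarith
    then have "?s * norm (F i x) \<le> 2 * real n" using e by (simp add: add scale)
    then show ?thesis using False e by (simp add: field_simps)
  qed
  then show ?thesis by blast
qed

text \<open>This is what makes derivatives of bounded evaluations bounded: a derivative is a pointwise limit of
  difference quotients.\<close>
lemma Banach_Steinhaus_pointwise_limit:
  fixes F :: "nat \<Rightarrow> 'a::{real_normed_vector, complete_space} \<Rightarrow> 'b::real_normed_vector"
  assumes bl: "\<And>n. bounded_linear (F n)" and lim: "\<And>x. (\<lambda>n. F n x) \<longlonglongrightarrow> L x"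
  shows "bounded_linear L"
proof -
  have "\<exists>B. \<forall>n\<in>UNIV. norm (F n x) \<le> B" for x
    using convergent_imp_Bseq[OF convergentI[OF lim[of x]]] by (auto simp: Bseq_def)
  then obtain K where K: "\<And>n x. norm (F n x) \<le> K * norm x"
    using uniform_boundedness_principle[of UNIV F] bl by auto
  show ?thesis
  proof (rule bounded_linear_intro[where K = K])
    show "L (x + y) = L x + L y" for x y
    proof (rule LIMSEQ_unique[OF lim])
      show "(\<lambda>n. F n (x + y)) \<longlonglongrightarrow> L x + L y"
        using tendsto_add[OF lim[of x] lim[of y]]
        by (simp add: linear_add[OF bounded_linear.linear[OF bl]])
    qed
    show "L (r *\<^sub>R x) = r *\<^sub>R L x" for r x
    proof (rule LIMSEQ_unique[OF lim])
      show "(\<lambda>n. F n (r *\<^sub>R x)) \<longlonglongrightarrow> r *\<^sub>R L x"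
        using tendsto_scaleR[OF tendsto_const lim[of x]]
        by (simp add: linear_scale[OF bounded_linear.linear[OF bl]])
    qed
    show "norm (L x) \<le> norm x * K" for x
      by (rule tendsto_upperbound[OF tendsto_norm[OF lim[of x]]]) (use K in \<open>auto simp: mult.commute\<close>)
  qed
qed

section \<open>Quotients determined by joint eigenfunctionals\<close>

lemma orth_compl_antimono: "S \<subseteq> T \<Longrightarrow> orth_compl T \<subseteq> orth_compl S"
  by (auto simp: orth_compl_def)

lemma orth_compl_iff_cinner_right: "y \<in> orth_compl S \<longleftrightarrow> (\<forall>x\<in>S. cinner x y = 0)"
proof -
  have "cinner x y = 0 \<longleftrightarrow> cinner y x = 0" for x :: 'a
    using cinner_commute[of x y] by simp
  then show ?thesis by (auto simp: orth_compl_def)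
qed

text \<open>If \<open>\<langle>e\<^sub>b, k\<^sub>a\<rangle> = \<delta>\<^sub>a\<^sub>b\<close>, subtracting \<open>\<Sum> \<langle>x, k\<^sub>b\<rangle> e\<^sub>b\<close> moves any \<open>x\<close> into the orthogonal complement
  of the \<open>k\<^sub>a\<close>. Pairing with \<open>y\<close> in the double complement expands \<open>y\<close> in the \<open>k\<^sub>a\<close>, so the span of the
  \<open>k\<^sub>a\<close> is the whole double complement.\<close>
lemma biorthogonal_system_orth_compl:
  fixes k :: "'i \<Rightarrow> 'h::complex_hilbert"
  assumes fin: "finite I"
    and bi: "\<And>a b. a \<in> I \<Longrightarrow> b \<in> I \<Longrightarrow> cinner (e b) (k a) = (if a = b then 1 else 0)"
  shows "inj_on k I" and "complex_vector.independent (k ` I)"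
    and "complex_vector.span (k ` I) = orth_compl (orth_compl (k ` I))"
proof -
  show inj: "inj_on k I"
    by (rule inj_onI) (metis bi zero_neq_one)
  show "complex_vector.independent (k ` I)"
  proof (rule complex_vector.independent_if_scalars_zero)
    fix c x assume 0: "(\<Sum>x\<in>k ` I. c x *\<^sub>C x) = 0" and "x \<in> k ` I"
    then obtain b where b: "b \<in> I" "x = k b" by blast
    have "0 = cinner (e b) (\<Sum>a\<in>I. c (k a) *\<^sub>C k a)"
      using 0 by (simp add: sum.reindex[OF inj])
    also have "\<dots> = (\<Sum>a\<in>I. if a = b then cnj (c (k a)) else 0)"
      unfolding cinner_sum_right by (intro sum.cong) (use b in \<open>auto simp: cinner_scaleC_right bi\<close>)
    finally show "c x = 0" using b fin by simp
  qed (use fin in simp)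
  show "complex_vector.span (k ` I) = orth_compl (orth_compl (k ` I))"
  proof
    show "complex_vector.span (k ` I) \<subseteq> orth_compl (orth_compl (k ` I))"
      by (rule complex_vector.span_minimal[OF _ subspace_orth_compl])
        (simp add: subset_iff orth_compl_iff_cinner_right, auto simp: orth_compl_def)
    show "orth_compl (orth_compl (k ` I)) \<subseteq> complex_vector.span (k ` I)"
    proof
      fix y assume y: "y \<in> orth_compl (orth_compl (k ` I))"
      have "cinner x y = cinner x (\<Sum>b\<in>I. cnj (cinner (e b) y) *\<^sub>C k b)" for x
      proof -
        have "cinner (x - (\<Sum>b\<in>I. cinner x (k b) *\<^sub>C e b)) (k a) = 0" if "a \<in> I" for a
          using that fin by (simp add: cinner_diff_left cinner_sum_left cinner_scaleC_left bi
              if_distrib cong: if_cong)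
        then have "x - (\<Sum>b\<in>I. cinner x (k b) *\<^sub>C e b) \<in> orth_compl (k ` I)"
          by (auto simp: orth_compl_def)
        then have "cinner (x - (\<Sum>b\<in>I. cinner x (k b) *\<^sub>C e b)) y = 0"
          using y by (auto simp: orth_compl_iff_cinner_right)
        then show ?thesis
          by (simp add: cinner_diff_left cinner_sum_left cinner_sum_right cinner_scaleC_left
              cinner_scaleC_right mult.commute)
      qed
      then have "y = (\<Sum>b\<in>I. cnj (cinner (e b) y) *\<^sub>C k b)"
        by (subst cinner_eq_iff[symmetric]) blast
      also have "\<dots> \<in> complex_vector.span (k ` I)"
        by (intro complex_vector.span_sum complex_vector.span_scale complex_vector.span_base) auto
      finally show "y \<in> complex_vector.span (k ` I)" .
    qed
  qed
qed

lemma bounded_linear_vec_lambda_components: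
  fixes f :: "'n::finite \<Rightarrow> 'a::real_normed_vector \<Rightarrow> 'b::real_normed_vector"
  assumes "\<And>j. bounded_linear (f j)"
  shows "bounded_linear (\<lambda>x. \<chi> j. f j x)"
proof -
  interpret f: bounded_linear "f j" for j by (rule assms)
  obtain K where K: "\<And>j x. norm (f j x) \<le> norm x * K j" using f.bounded by metis
  show ?thesis
  proof (rule bounded_linear_intro[where K = "\<Sum>j\<in>UNIV. K j"])
    fix x
    have "norm (\<chi> j. f j x) \<le> (\<Sum>j\<in>UNIV. norm (f j x))"
      unfolding norm_vec_def by (simp add: L2_set_le_sum)
    also have "\<dots> \<le> (\<Sum>j\<in>UNIV. norm x * K j)" by (intro sum_mono K)
    finally show "norm (\<chi> j. f j x) \<le> norm x * (\<Sum>j\<in>UNIV. K j)" by (simp add: sum_distrib_left)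
  qed (auto simp: vec_eq_iff f.add f.scale)
qed

lemma conj_set_iff: "(\<chi> i. cnj (z $ i)) \<in> conj_set V \<longleftrightarrow> z \<in> V"
  by (auto simp: conj_set_def image_iff vec_eq_iff) (metis vec_eq_iff)

lemma open_conj_set:
  assumes "open V"
  shows "open (conj_set V)"
proof -
  have "conj_set V = (\<lambda>z. \<chi> i. cnj (z $ i)) -` V"
  proof (intro set_eqI)
    fix z
    show "z \<in> conj_set V \<longleftrightarrow> z \<in> (\<lambda>z. \<chi> i. cnj (z $ i)) -` V"
      using conj_set_iff[of "\<chi> i. cnj (z $ i)" V] by simp
  qed
  moreover have "continuous_on UNIV (\<lambda>z::complex ^ 'a. \<chi> i. cnj (z $ i))"
    by (intro continuous_intros)
  ultimately show ?thesis using assms by (auto intro: open_vimage)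
qed

text \<open>The operator-theoretic core. For each \<open>w \<in> V\<close> there are finitely many joint eigenfunctionals
  \<open>\<phi> w a\<close> of the tuple \<open>M\<close> with eigenvalue \<open>w\<close>; let \<open>L w\<close> be their common kernel, so that \<open>S\<close> is the
  intersection of all \<open>L w\<close>. Since \<open>S\<close> is invariant, the adjoint of the compression to \<open>S\<^sup>\<bottom>\<close> is the
  restriction of the adjoint of \<open>M\<close>. By the eigenvalue equations and the hypothesis \<open>gen\<close>,
  \<open>L w = S + \<Sum>\<^sub>j ran (M\<^sub>j - w\<^sub>j)\<close>, and the clauses of the class are read off from this. The joint eigenspace is \<open>(L w)\<^sup>\<bottom>\<close>, spanned by the Riesz
  representatives of the \<open>\<phi> w a\<close>, which are independent by biorthogonality. The range is closed
  because the joint operator is bounded below on \<open>S\<^sup>\<bottom> \<inter> L w\<close>. The eigenspaces are total because a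
  vector orthogonal to all of them is killed by every \<open>\<phi> w a\<close>, that is, lies in \<open>S\<close>.\<close>
lemma quotient_tuple_in_class_B:
  fixes M :: "'n::finite \<Rightarrow> 'h::complex_hilbert \<Rightarrow> 'h"
    and \<phi> :: "complex ^ 'n \<Rightarrow> 'i \<Rightarrow> 'h \<Rightarrow> complex" and e :: "complex ^ 'n \<Rightarrow> 'i \<Rightarrow> 'h"
  assumes V: "open V" and fin: "finite I"
    and M: "\<And>j. bounded_linear (M j)" and Mhom: "\<And>j c h. M j (c *\<^sub>C h) = c *\<^sub>C M j h"
    and comm: "\<And>i j h. M i (M j h) = M j (M i h)"
    and \<phi>: "\<And>w a. w \<in> V \<Longrightarrow> a \<in> I \<Longrightarrow> bounded_linear (\<phi> w a)"
    and \<phi>hom: "\<And>w a c h. w \<in> V \<Longrightarrow> a \<in> I \<Longrightarrow> \<phi> w a (c *\<^sub>C h) = c * \<phi> w a h"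
    and eig: "\<And>w a j h. w \<in> V \<Longrightarrow> a \<in> I \<Longrightarrow> \<phi> w a (M j h) = w $ j * \<phi> w a h"
    and biorth: "\<And>w a b. w \<in> V \<Longrightarrow> a \<in> I \<Longrightarrow> b \<in> I \<Longrightarrow> \<phi> w a (e w b) = (if a = b then 1 else 0)"
    and S_def: "S = {h. \<forall>w\<in>V. \<forall>a\<in>I. \<phi> w a h = 0}"
    and gen: "\<And>w h. w \<in> V \<Longrightarrow> (\<forall>a\<in>I. \<phi> w a h = 0) \<Longrightarrow>
      \<exists>g\<in>S. \<exists>u. h = g + (\<Sum>j\<in>UNIV. M j (u j) - w $ j *\<^sub>C u j)"
  shows "operator_class_B (card I) (conj_set V) (orth_compl S)
           (\<lambda>j. adjoint_on (orth_compl S) (\<lambda>h. orth_proj (orth_compl S) (M j h)))"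
proof -
  define Q where "Q = orth_compl S"
  define T where "T j = adjoint_on Q (\<lambda>h. orth_proj Q (M j h))" for j
  interpret M: bounded_linear "M j" for j by (rule M)
  have Qs: "complex_vector.subspace Q" and Qc: "closed Q"
    unfolding Q_def by (rule subspace_orth_compl closed_orth_compl)+
  have "\<exists>k. \<forall>h. \<phi> w a h = cinner h k" if "w \<in> V" "a \<in> I" for w a
    using that by (intro Riesz_representation \<phi> \<phi>hom)
  then obtain k where k: "\<And>w a h. w \<in> V \<Longrightarrow> a \<in> I \<Longrightarrow> \<phi> w a h = cinner h (k w a)" by metis
  have "\<exists>A. bounded_linear A \<and> (\<forall>c x. A (c *\<^sub>C x) = c *\<^sub>C A x) \<and>
             (\<forall>x y. cinner (M j x) y = cinner x (A y))" for j
    by (intro ex_adjoint M Mhom)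
  then obtain A where A: "\<And>j. bounded_linear (A j)" and Ahom: "\<And>j c x. A j (c *\<^sub>C x) = c *\<^sub>C A j x"
    and Aadj: "\<And>j x y. cinner (M j x) y = cinner x (A j y)"
    by metis
  interpret A: bounded_linear "A j" for j by (rule A)
  have Acomm: "A i (A j y) = A j (A i y)" for i j y
    by (subst cinner_eq_iff[symmetric]) (simp add: Aadj[symmetric] comm)

  define L where "L w = {h. \<forall>a\<in>I. \<phi> w a h = 0}" for w
  have L_eq: "L w = orth_compl (k w ` I)" if "w \<in> V" for w
    using that by (auto simp: L_def orth_compl_def k)
  have Ls: "complex_vector.subspace (L w)" and Lc: "closed (L w)" if "w \<in> V" for w
    unfolding L_eq[OF that] by (rule subspace_orth_compl closed_orth_compl)+
  have SL: "S \<subseteq> L w" if "w \<in> V" for w using that by (auto simp: S_def L_def)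
  have M_L: "M j h - w $ j *\<^sub>C h \<in> L w" if "w \<in> V" for w j h
    using that linear_diff[OF bounded_linear.linear[OF \<phi>]] by (simp add: L_def eig \<phi>hom)
  have M_S: "M j h \<in> S" if "h \<in> S" for j h
    using that by (auto simp: S_def eig)

  have AQ: "A j y \<in> Q" if "y \<in> Q" for j y
    using that M_S by (auto simp: Q_def orth_compl_iff_cinner_right Aadj[symmetric])
  have TA: "T j y = A j y" if y: "y \<in> Q" for j y
    unfolding T_def adjoint_on_def
  proof (rule the_equality)
    show "A j y \<in> Q \<and> (\<forall>x\<in>Q. cinner (orth_proj Q (M j x)) y = cinner x (A j y))"
      using AQ y orth_proj_cinner[OF Qs Qc] by (auto simp: Aadj)
    fix v assume v: "v \<in> Q \<and> (\<forall>x\<in>Q. cinner (orth_proj Q (M j x)) y = cinner x v)"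
    then have "v - A j y \<in> Q" using AQ[OF y] complex_vector.subspace_diff[OF Qs] by blast
    then have "cinner (v - A j y) v = cinner (v - A j y) (A j y)"
      using v y orth_proj_cinner[OF Qs Qc] by (metis Aadj)
    then have "cinner (v - A j y) (v - A j y) = 0" by (simp add: cinner_diff_right)
    then show "v = A j y" by simp
  qed

  define D where "D w y = (\<chi> j. A j y - cnj (w $ j) *\<^sub>C y)" for w y
  have D_op_eq: "D_op T (\<chi> i. cnj (w $ i)) y = D w y" if "y \<in> Q" for w y
    using that by (simp add: D_op_def D_def TA)
  have D_bl: "bounded_linear (D w)" for w
    unfolding D_def
    by (intro bounded_linear_vec_lambda_components bounded_linear_sub A bounded_linear_scaleC_right)
  interpret D: bounded_linear "D w" for w by (rule D_bl)
  have cinner_D: "cinner (M j x - w $ j *\<^sub>C x) y = cinner x (D w y $ j)" for j w x y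
    by (simp add: D_def cinner_diff_left cinner_diff_right Aadj cinner_scaleC_left cinner_scaleC_right)
  \<comment> \<open>On \<open>Q\<close>, pairing with a vector of \<open>L w\<close> factors through \<open>D w\<close>: the \<open>S\<close>-part drops out.\<close>
  have L_repr: "\<exists>u. \<forall>y\<in>Q. cinner h y = (\<Sum>j\<in>UNIV. cinner (u j) (D w y $ j))"
    if w: "w \<in> V" and h: "h \<in> L w" for w h
  proof -
    obtain g u where "g \<in> S" "h = g + (\<Sum>j\<in>UNIV. M j (u j) - w $ j *\<^sub>C u j)"
      using gen[OF w, of h] h unfolding L_def by blast
    then have "\<forall>y\<in>Q. cinner h y = (\<Sum>j\<in>UNIV. cinner (u j) (D w y $ j))"
      by (auto simp: cinner_add_left cinner_sum_left cinner_D Q_def orth_compl_iff_cinner_right)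
    then show ?thesis by blast
  qed
  have ker: "{y \<in> Q. D w y = 0} = orth_compl (L w)" if w: "w \<in> V" for w
  proof
    show "{y \<in> Q. D w y = 0} \<subseteq> orth_compl (L w)"
    proof clarify
      fix y assume y: "y \<in> Q" "D w y = 0"
      show "y \<in> orth_compl (L w)"
        unfolding orth_compl_iff_cinner_right using L_repr[OF w] y by fastforce
    qed
    show "orth_compl (L w) \<subseteq> {y \<in> Q. D w y = 0}"
    proof clarify
      fix y assume y: "y \<in> orth_compl (L w)"
      then have "y \<in> Q" using orth_compl_antimono[OF SL[OF w]] by (auto simp: Q_def)
      moreover have "D w y $ j = 0" for j
      proof -
        have "cinner x (D w y $ j) = cinner x 0" for x
          using y M_L[OF w, of j x] by (auto simp: orth_compl_iff_cinner_right cinner_D[symmetric])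
        then show ?thesis using cinner_eq_iff by blast
      qed
      ultimately show "y \<in> Q \<and> D w y = 0" by (simp add: vec_eq_iff)
    qed
  qed
  have D_ker_eq: "D_ker Q T (\<chi> i. cnj (w $ i)) = orth_compl (L w)" if "w \<in> V" for w
    unfolding ker[OF that, symmetric] by (auto simp: D_ker_def D_op_eq)
  have ker_span: "inj_on (k w) I" "complex_vector.independent (k w ` I)"
      "complex_vector.span (k w ` I) = orth_compl (L w)" if w: "w \<in> V" for w
  proof -
    have "cinner (e w b) (k w a) = (if a = b then 1 else 0)" if "a \<in> I" "b \<in> I" for a b
      using that w by (simp add: k[symmetric] biorth)
    then show "inj_on (k w) I" "complex_vector.independent (k w ` I)"
      "complex_vector.span (k w ` I) = orth_compl (L w)"
      unfolding L_eq[OF w] by (rule biorthogonal_system_orth_compl[OF fin]; simp)+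
  qed

  have closed_range: "closed (D w ` Q)" if w: "w \<in> V" for w
  proof -
    \<comment> \<open>The vectors of \<open>Q \<inter> L w\<close> with image in the unit ball are weakly bounded: projecting the test
      vector to \<open>L w\<close> lets the pairing factor through \<open>D w\<close>. Uniform boundedness then gives a norm
      bound, which is the lower bound for \<open>D w\<close>.\<close>
    define Y where "Y = {y \<in> Q \<inter> L w. norm (D w y) \<le> 1}"
    have "\<exists>B. \<forall>y\<in>Y. norm (cinner x y) \<le> B" for x
    proof -
      define p where "p = orth_proj (L w) x"
      obtain u where u: "\<And>y. y \<in> Q \<Longrightarrow> cinner p y = (\<Sum>j\<in>UNIV. cinner (u j) (D w y $ j))"
        using L_repr[OF w, of p] orth_proj_mem[OF Ls[OF w] Lc[OF w]] by (auto simp: p_def)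
      have "norm (cinner x y) \<le> (\<Sum>j\<in>UNIV. norm (u j))" if y: "y \<in> Y" for y
      proof -
        have "cinner x y = (\<Sum>j\<in>UNIV. cinner (u j) (D w y $ j))"
          using y u orth_proj_cinner[OF Ls[OF w] Lc[OF w], of y x] by (auto simp: Y_def p_def)
        also have "norm \<dots> \<le> (\<Sum>j\<in>UNIV. norm (u j))"
        proof (rule sum_norm_le)
          fix j
          have "norm (D w y $ j) \<le> 1"
            using y Finite_Cartesian_Product.norm_nth_le[of "D w y" j] by (auto simp: Y_def)
          then show "norm (cinner (u j) (D w y $ j)) \<le> norm (u j)"
            using cinner_Cauchy_Schwarz[of "u j" "D w y $ j"]
              mult_left_mono[of "norm (D w y $ j)" 1 "norm (u j)"] by simp
        qed
        finally show ?thesis .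
      qed
      then show ?thesis by blast
    qed
    then obtain K where K: "\<And>x y. y \<in> Y \<Longrightarrow> norm (cinner x y) \<le> K * norm x"
      using uniform_boundedness_principle[of Y "\<lambda>y x. cinner x y"]
        bounded_linear_cinner_left by blast
    have below: "norm y \<le> (\<bar>K\<bar> + 1) * norm (D w y)" if y: "y \<in> Q \<inter> L w" for y
    proof (cases "D w y = 0")
      case True
      then have "y \<in> orth_compl (L w)" using y ker[OF w] by blast
      then have "cinner y y = 0" using y by (auto simp: orth_compl_def)
      then show ?thesis by simp
    next
      case False
      define t where "t = 1 / norm (D w y)"
      have t: "t > 0" "D w (t *\<^sub>R y) = t *\<^sub>R D w y" using False by (auto simp: t_def D.scale)
      have "t *\<^sub>R y \<in> Q \<inter> L w"
        using y complex_vector.subspace_scale[OF Qs, of y "of_real t"]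
          complex_vector.subspace_scale[OF Ls[OF w], of y "of_real t"] by (auto simp: scaleC_of_real)
      then have "t *\<^sub>R y \<in> Y" using False by (simp add: Y_def t) (simp add: t_def)
      then have "(norm (t *\<^sub>R y))\<^sup>2 \<le> K * norm (t *\<^sub>R y)"
        using K[of "t *\<^sub>R y" "t *\<^sub>R y"] by (simp only: cinner_self norm_of_real) simp
      then have "norm (t *\<^sub>R y) \<le> \<bar>K\<bar> + 1"
        by (cases "norm (t *\<^sub>R y) = 0") (auto simp: power2_eq_square mult_le_cancel_right)
      then show ?thesis using False by (simp add: t_def field_simps)
    qed
    have "complete (D w ` (Q \<inter> L w))"
    proof (rule complete_isometric_image[where e = "1 / (\<bar>K\<bar> + 1)"])
      show "0 < 1 / (\<bar>K\<bar> + 1)" by simp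
      show "subspace (Q \<inter> L w)"
        by (intro subspace_inter complex_subspace_imp_real_subspace Qs Ls[OF w])
      show "\<forall>x\<in>Q \<inter> L w. 1 / (\<bar>K\<bar> + 1) * norm x \<le> norm (D w x)"
        using below by (simp add: field_simps)
      show "complete (Q \<inter> L w)"
        using Qc Lc[OF w] by (simp add: complete_eq_closed closed_Int)
    qed (rule D_bl)
    moreover have "D w ` Q = D w ` (Q \<inter> L w)"
    proof
      \<comment> \<open>The component of a vector orthogonal to \<open>L w\<close> lies in the kernel of \<open>D w\<close>.\<close>
      show "D w ` Q \<subseteq> D w ` (Q \<inter> L w)"
      proof clarify
        fix y assume y: "y \<in> Q"
        let ?p = "orth_proj (L w) y"
        have "y - ?p \<in> orth_compl (L w)"
          using orth_proj_orth[OF Ls[OF w] Lc[OF w]] by (auto simp: orth_compl_def)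
        then have "y - ?p \<in> Q" "D w (y - ?p) = 0" using ker[OF w] by blast+
        moreover from this have "?p \<in> Q"
          using complex_vector.subspace_diff[OF Qs y] by fastforce
        ultimately show "D w y \<in> D w ` (Q \<inter> L w)"
          using orth_proj_mem[OF Ls[OF w] Lc[OF w], of y] by (auto simp: D.diff)
      qed
    qed auto
    ultimately show ?thesis by (simp add: complete_eq_closed)
  qed

  have dense: "closure (complex_vector.span (\<Union>w\<in>V. orth_compl (L w))) = Q"
    (is "closure (complex_vector.span ?U) = Q")
  proof
    have "?U \<subseteq> Q" using orth_compl_antimono[OF SL] by (auto simp: Q_def)
    then have "complex_vector.span ?U \<subseteq> Q" by (intro complex_vector.span_minimal Qs)
    then show "closure (complex_vector.span ?U) \<subseteq> Q" by (intro closure_minimal Qc)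
    let ?W = "closure (complex_vector.span ?U)"
    have W: "orth_compl (orth_compl ?W) = ?W"
      by (intro orth_compl_orth_compl closure_complex_subspace complex_vector.subspace_span closed_closure)
    have "orth_compl ?W \<subseteq> S"
    proof
      fix x assume x: "x \<in> orth_compl ?W"
      have "\<phi> w a x = 0" if w: "w \<in> V" and a: "a \<in> I" for w a
      proof -
        have "k w a \<in> orth_compl (L w)"
          unfolding ker_span(3)[OF w, symmetric] using a by (auto intro: complex_vector.span_base)
        then have "k w a \<in> ?U" using w by blast
        then have "k w a \<in> ?W" by (intro subsetD[OF closure_subset] complex_vector.span_base)
        then show ?thesis using x k[OF w a] by (auto simp: orth_compl_def)
      qed
      then show "x \<in> S" by (auto simp: S_def)
    qed
    then have "Q \<subseteq> orth_compl (orth_compl ?W)" unfolding Q_def by (rule orth_compl_antimono)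
    then show "Q \<subseteq> ?W" by (simp only: W)
  qed

  have conj_ball: "(\<forall>z\<in>conj_set V. P z) \<longleftrightarrow> (\<forall>w\<in>V. P (\<chi> i. cnj (w $ i)))" for P
    by (auto simp: conj_set_def)
  have "bounded_op_on Q (T j)" for j
    unfolding bounded_op_on_def
  proof (intro conjI ballI allI)
    obtain K where "\<And>x. norm (A j x) \<le> norm x * K" using A.bounded by blast
    then show "\<exists>K. \<forall>x\<in>Q. norm (T j x) \<le> K * norm x" by (auto simp: TA mult.commute)
  qed (use Qs in \<open>simp_all add: TA AQ A.add Ahom complex_vector.subspace_add complex_vector.subspace_scale\<close>)
  moreover have "T i (T j h) = T j (T i h)" if "h \<in> Q" for i j h
    using that AQ by (simp add: TA Acomm)
  moreover have "\<exists>B. finite B \<and> card B = card I \<and> complex_vector.independent B \<and>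
      complex_vector.span B = D_ker Q T (\<chi> i. cnj (w $ i))" if w: "w \<in> V" for w
    using ker_span[OF w] fin D_ker_eq[OF w] by (intro exI[of _ "k w ` I"]) (auto simp: card_image)
  moreover have "D_op T (\<chi> i. cnj (w $ i)) ` Q = D w ` Q" for w
    by (auto simp: D_op_eq)
  moreover have "(\<Union>z\<in>conj_set V. D_ker Q T z) = (\<Union>w\<in>V. orth_compl (L w))"
    by (auto simp: conj_set_def D_ker_eq)
  ultimately have "operator_class_B (card I) (conj_set V) Q T"
    unfolding operator_class_B_def using open_conj_set[OF V] Qs Qc closed_range dense
    by (auto simp: conj_ball)
  then show ?thesis by (simp add: Q_def T_def[abs_def])
qed

section \<open>Holomorphy on complex lines\<close>

text \<open>Continuity together with holomorphy on every complex line. By Osgood's lemma this is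
  holomorphy, but in this form closure under partial derivatives follows from one-variable theory:
  the class is closed under locally uniform limits, and a partial derivative is such a limit of
  difference quotients.\<close>
definition hol_on_lines :: "(complex ^ 'n::finite) set \<Rightarrow> (complex ^ 'n \<Rightarrow> complex) \<Rightarrow> bool" where
  "hol_on_lines U f \<longleftrightarrow> continuous_on U f \<and>
     (\<forall>z v. (\<lambda>t. f (z + t *s v)) holomorphic_on {t. z + t *s v \<in> U})"

lemma bounded_linear_complex_line: "bounded_linear (\<lambda>t. t *s (v :: complex ^ 'n::finite))"
proof -
  have "bounded_linear (\<lambda>t. \<chi> i. t * v $ i)"
    by (intro bounded_linear_vec_lambda_components bounded_linear_mult_left)
  then show ?thesis by (simp add: vector_scalar_mult_def)
qed

lemma continuous_on_complex_line:
  "continuous_on S (\<lambda>t. z + t *s (v :: complex ^ 'n::finite))"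
  by (intro continuous_intros linear_continuous_on bounded_linear_complex_line)

lemma open_complex_line_vimage:
  "open U \<Longrightarrow> open {t. z + t *s (v :: complex ^ 'n::finite) \<in> U}"
  using open_vimage[OF _ continuous_on_complex_line] by (simp add: vimage_def)

lemma norm_scaled_axis: "norm (t *s axis i (1::complex)) = cmod t"
proof -
  have "t *s axis i (1::complex) = axis i t" by (simp add: vec_eq_iff axis_def)
  moreover have "(\<Sum>j\<in>UNIV. (cmod (axis i t $ j))\<^sup>2) = (cmod t)\<^sup>2"
    by (subst sum.remove[of UNIV i]) (auto simp: axis_def intro!: sum.neutral)
  ultimately show ?thesis by (simp add: norm_vec_def L2_set_def)
qed

lemma holomorphic_several_imp_hol_on_lines:
  assumes "holomorphic_several f U" "open U"
  shows "hol_on_lines U f"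
  unfolding hol_on_lines_def
proof (intro conjI allI)
  show "continuous_on U f"
    using assms unfolding holomorphic_several_def
    by (metis continuous_at_imp_continuous_on has_derivative_continuous)
  fix z v
  show "(\<lambda>t. f (z + t *s v)) holomorphic_on {t. z + t *s v \<in> U}"
    unfolding holomorphic_on_open[OF open_complex_line_vimage[OF \<open>open U\<close>]]
  proof clarify
    fix t assume "z + t *s v \<in> U"
    then obtain D where D: "(f has_derivative D) (at (z + t *s v))" "\<And>c v. D (c *s v) = c * D v"
      using assms unfolding holomorphic_several_def by blast
    have "((\<lambda>t. z + t *s v) has_derivative (\<lambda>s. s *s v)) (at t)"
      using has_derivative_add[OF has_derivative_const
          bounded_linear_imp_has_derivative[OF bounded_linear_complex_line]] by simp
    from has_derivative_compose[OF this D(1)]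
    have "((\<lambda>t. f (z + t *s v)) has_derivative (\<lambda>s. D v * s)) (at t)"
      by (simp add: D(2) mult.commute)
    then show "\<exists>f'. ((\<lambda>t. f (z + t *s v)) has_field_derivative f') (at t)"
      unfolding has_field_derivative_def by blast
  qed
qed

text \<open>The error of the difference quotient is controlled by the supremum of \<open>\<bar>g\<bar>\<close> alone: on the half disc
  Cauchy's inequality with radius \<open>R / 4\<close> gives \<open>\<bar>g''\<bar> \<le> 2 C / (R / 4)\<^sup>2 = 32 C / R\<^sup>2\<close>, and Taylor's
  formula does the rest.\<close>
lemma difference_quotient_estimate:
  assumes hol: "g holomorphic_on ball 0 R" and bd: "\<And>t. t \<in> ball 0 R \<Longrightarrow> cmod (g t) \<le> C"
    and s: "s \<noteq> 0" "cmod s < R / 2"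
  shows "cmod ((g s - g 0) / s - deriv g 0) \<le> 32 * C / R\<^sup>2 * cmod s"
proof -
  have R: "R > 0" using s norm_ge_zero[of s] by linarith
  let ?S = "ball (0::complex) (R / 2)"
  have hd: "((deriv ^^ i) g has_field_derivative (deriv ^^ Suc i) g x) (at x within ?S)"
    if "x \<in> ?S" for i x
  proof -
    have "(deriv ^^ i) g holomorphic_on ball 0 R" by (intro holomorphic_higher_deriv hol) auto
    moreover have "x \<in> ball 0 R" using that R by auto
    ultimately show ?thesis
      by (auto intro: has_field_derivative_at_within holomorphic_derivI)
  qed
  have "cmod (g s - (\<Sum>i\<le>1. (deriv ^^ i) g 0 * (s - 0) ^ i / fact i))
      \<le> (32 * C / R\<^sup>2) * cmod (s - 0) ^ Suc 1 / fact 1"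
  proof (rule complex_Taylor[where f = "\<lambda>i. (deriv ^^ i) g" and S = ?S, simplified funpow_0])
    fix w assume w: "w \<in> ?S"
    have sub: "cball w (R/4) \<subseteq> ball 0 R"
    proof
      fix x assume "x \<in> cball w (R/4)"
      then show "x \<in> ball 0 R"
        using w R norm_triangle_ineq2[of x w] by (simp add: dist_norm norm_minus_commute)
    qed
    have "cmod ((deriv ^^ 2) g w) \<le> fact 2 * C / (R/4)^2"
    proof (rule Cauchy_inequality)
      show "g holomorphic_on ball w (R/4)"
        using holomorphic_on_subset[OF hol] sub ball_subset_cball by blast
      show "continuous_on (cball w (R/4)) g"
        using holomorphic_on_imp_continuous_on[OF hol] continuous_on_subset sub by blast
      show "cmod (g x) \<le> C" if "norm (w - x) = R/4" for x
        using that sub by (intro bd) (auto simp: dist_norm)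
    qed (use R in simp)
    then show "cmod ((deriv ^^ Suc 1) g w) \<le> 32 * C / R\<^sup>2"
      by (simp add: numeral_2_eq_2 power_divide field_simps)
  qed (use s R hd in auto)
  then have est: "cmod (g s - g 0 - deriv g 0 * s) \<le> 32 * C / R\<^sup>2 * cmod s ^ 2"
    by (simp add: diff_diff_eq power2_eq_square)
  have "cmod ((g s - g 0) / s - deriv g 0) * cmod s = cmod (g s - g 0 - deriv g 0 * s)"
  proof -
    have "(g s - g 0) / s - deriv g 0 = (g s - g 0 - deriv g 0 * s) / s"
      using s by (simp add: field_simps)
    then show ?thesis using s by (simp add: norm_divide)
  qed
  also have "\<dots> \<le> (32 * C / R\<^sup>2 * cmod s) * cmod s"
    using est by (simp add: power2_eq_square mult_ac)
  finally show ?thesis by (rule mult_right_le_imp_le) (use s in simp)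
qed

text \<open>A continuous function is bounded on a compact ball, so one bound serves the estimate on all the
  discs in direction \<open>i\<close> centred in the concentric ball of half the radius.\<close>
lemma cpartial_uniform_limit:
  fixes f :: "complex ^ 'n::finite \<Rightarrow> complex"
  assumes U: "open U" and f: "hol_on_lines U f" and z0: "z0 \<in> U"
  shows "\<exists>r>0. cball z0 (2 * r) \<subseteq> U \<and>
    uniform_limit (cball z0 r)
      (\<lambda>n z. (f (z + inverse (of_nat (Suc n)) *s axis i 1) - f z) / inverse (of_nat (Suc n)))
      (cpartial i f) sequentially"
proof -
  obtain R where R: "R > 0" "cball z0 R \<subseteq> U" using U z0 open_contains_cball by blast
  define r where "r = R / 2"
  have r: "r > 0" "cball z0 (2 * r) \<subseteq> U" using R by (auto simp: r_def)
  have "compact (f ` cball z0 (2 * r))"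
    using f r by (intro compact_continuous_image) (auto simp: hol_on_lines_def intro: continuous_on_subset)
  then obtain C where C: "\<And>z. z \<in> cball z0 (2 * r) \<Longrightarrow> cmod (f z) \<le> C"
    using compact_imp_bounded by (force simp: bounded_iff)
  let ?e = "\<lambda>n. inverse (of_nat (Suc n)) :: complex"
  let ?b = "\<lambda>n. 32 * C / r\<^sup>2 * inverse (real (Suc n))"
  have est: "cmod ((f (z + ?e n *s axis i 1) - f z) / ?e n - cpartial i f z) \<le> ?b n"
    if z: "z \<in> cball z0 r" and n: "inverse (real (Suc n)) < r / 2" for n z
  proof -
    have sub: "z + t *s axis i 1 \<in> cball z0 (2 * r)" if "t \<in> ball 0 r" for t
    proof -
      have "dist z0 (z + t *s axis i 1) \<le> dist z0 z + norm (t *s axis i (1::complex) :: complex ^ 'n)"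
        using dist_triangle[of z0 "z + t *s axis i 1" z] by (simp add: dist_norm)
      then show ?thesis using z that by (simp add: norm_scaled_axis)
    qed
    have "(\<lambda>t. f (z + t *s axis i 1)) holomorphic_on ball 0 r"
      using f sub r(2) unfolding hol_on_lines_def by (blast intro: holomorphic_on_subset)
    moreover have "cmod (?e n) = inverse (real (Suc n))"
      by (simp only: norm_inverse norm_of_nat)
    moreover have "?e n \<noteq> 0" by (simp del: of_nat_Suc)
    ultimately show ?thesis
      using difference_quotient_estimate[of "\<lambda>t. f (z + t *s axis i 1)" r C "?e n"] C sub n
      by (simp add: cpartial_def del: of_nat_Suc)
  qed
  have lim0: "(\<lambda>n. inverse (real (Suc n))) \<longlonglongrightarrow> 0" by (rule LIMSEQ_inverse_real_of_nat)
  have "uniform_limit (cball z0 r) (\<lambda>n z. (f (z + ?e n *s axis i 1) - f z) / ?e n) (cpartial i f) sequentially"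
  proof (rule uniform_limitI)
    fix \<epsilon> :: real assume "\<epsilon> > 0"
    moreover have "?b \<longlonglongrightarrow> 0"
      using tendsto_mult[OF tendsto_const[of "32 * C / r\<^sup>2"] lim0] by (simp only: mult_zero_right)
    ultimately have "\<forall>\<^sub>F n in sequentially. ?b n < \<epsilon>" by (rule order_tendstoD(2)[rotated])
    moreover have "\<forall>\<^sub>F n in sequentially. inverse (real (Suc n)) < r / 2"
      using r by (intro order_tendstoD(2)[OF lim0]) auto
    ultimately show "\<forall>\<^sub>F n in sequentially. \<forall>z\<in>cball z0 r.
        dist ((f (z + ?e n *s axis i 1) - f z) / ?e n) (cpartial i f z) < \<epsilon>"
      by eventually_elim (use est in \<open>fastforce simp only: dist_norm\<close>)
  qed
  then show ?thesis using r by blast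
qed

text \<open>Both halves of the definition pass to the locally uniform limit.\<close>
lemma hol_on_lines_cpartial:
  fixes f :: "complex ^ 'n::finite \<Rightarrow> complex"
  assumes U: "open U" and f: "hol_on_lines U f"
  shows "hol_on_lines U (cpartial i f)"
proof -
  let ?e = "\<lambda>n. inverse (of_nat (Suc n)) :: complex"
  let ?q = "\<lambda>n z. (f (z + ?e n *s axis i 1) - f z) / ?e n"
  have shift: "z + ?e n *s axis i 1 \<in> cball z0 (2 * r)"
    if z: "z \<in> cball z0 r" and n: "inverse (real (Suc n)) < r" for z z0 :: "complex ^ 'n" and r n
  proof -
    have "dist z0 (z + ?e n *s axis i 1) \<le> dist z0 z + norm (?e n *s axis i (1::complex) :: complex ^ 'n)"
      using dist_triangle[of z0 "z + ?e n *s axis i 1" z] by (simp add: dist_norm)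
    also have "norm (?e n *s axis i (1::complex) :: complex ^ 'n) = inverse (real (Suc n))"
      by (simp only: norm_scaled_axis norm_inverse norm_of_nat)
    finally show ?thesis using z n by simp
  qed
  have small: "\<forall>\<^sub>F n in sequentially. inverse (real (Suc n)) < r" if "r > 0" for r
    using that by (intro order_tendstoD(2)[OF LIMSEQ_inverse_real_of_nat])
  have contf: "continuous_on U f" using f by (simp add: hol_on_lines_def)
  show ?thesis
    unfolding hol_on_lines_def
  proof (intro conjI allI)
    have "\<exists>r>0. continuous_on (cball z0 r) (cpartial i f)" if z0: "z0 \<in> U" for z0
    proof -
      obtain r where r: "r > 0" "cball z0 (2 * r) \<subseteq> U"
        "uniform_limit (cball z0 r) ?q (cpartial i f) sequentially"
        using cpartial_uniform_limit[OF U f z0] by blast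
      have "\<forall>\<^sub>F n in sequentially. continuous_on (cball z0 r) (?q n)"
        using small[OF r(1)]
      proof eventually_elim
        case (elim n)
        have "continuous_on (cball z0 r) (\<lambda>z. f (z + ?e n *s axis i 1))"
          by (rule continuous_on_compose2[OF contf]) (use r shift elim in \<open>auto intro!: continuous_intros\<close>)
        moreover have "continuous_on (cball z0 r) f"
          using r by (intro continuous_on_subset[OF contf]) (auto simp: subset_iff)
        ultimately show ?case by (intro continuous_intros) (auto simp del: of_nat_Suc)
      qed
      then have "continuous_on (cball z0 r) (cpartial i f)"
        by (rule uniform_limit_theorem[OF _ r(3)]) simp
      then show ?thesis using r by blast
    qed
    then have local: "\<exists>r>0. continuous_on (cball z0 r) (cpartial i f)" if "z0 \<in> U" for z0
      using that by blast
    have "isCont (cpartial i f) z0" if z0: "z0 \<in> U" for z0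
    proof -
      obtain r where "r > 0" "continuous_on (cball z0 r) (cpartial i f)"
        using local[OF z0] by blast
      then show ?thesis by (intro continuous_on_interior[of "cball z0 r"]) simp_all
    qed
    then show "continuous_on U (cpartial i f)"
      by (intro continuous_at_imp_continuous_on) blast
  next
    fix z v
    show "(\<lambda>t. cpartial i f (z + t *s v)) holomorphic_on {t. z + t *s v \<in> U}"
      unfolding holomorphic_on_open[OF open_complex_line_vimage[OF U]]
    proof clarify
      fix t0 assume t0: "z + t0 *s v \<in> U"
      let ?z0 = "z + t0 *s v"
      obtain r where r: "r > 0" "cball ?z0 (2 * r) \<subseteq> U"
        "uniform_limit (cball ?z0 r) ?q (cpartial i f) sequentially"
        using cpartial_uniform_limit[OF U f t0] by blast
      have "t0 \<in> {t. z + t *s v \<in> ball ?z0 r}" using r by simp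
      then obtain d where d: "d > 0" "cball t0 d \<subseteq> {t. z + t *s v \<in> ball ?z0 r}"
        using open_complex_line_vimage[OF open_ball] open_contains_cball by blast
      have line: "z + t *s v \<in> cball ?z0 r" if "t \<in> cball t0 d" for t
        using d(2) that by fastforce
      have ul: "uniform_limit (cball t0 d) (\<lambda>n t. ?q n (z + t *s v)) (\<lambda>t. cpartial i f (z + t *s v)) sequentially"
        using uniform_limit_compose'[OF r(3), of "\<lambda>t. z + t *s v" "cball t0 d"] line by auto
      have "\<forall>\<^sub>F n in sequentially. (\<lambda>t. ?q n (z + t *s v)) holomorphic_on cball t0 d"
        using small[OF r(1)]
      proof eventually_elim
        case (elim n)
        have "(\<lambda>t. f ((z + ?e n *s axis i 1) + t *s v)) holomorphic_on cball t0 d"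
          using f shift[OF line elim] r(2) unfolding hol_on_lines_def
          by (elim conjE allE[of _ "z + ?e n *s axis i 1"] allE[of _ v])
            (erule holomorphic_on_subset, auto simp: algebra_simps)
        then have *: "(\<lambda>t. f ((z + t *s v) + ?e n *s axis i 1)) holomorphic_on cball t0 d"
          by (simp add: algebra_simps)
        have "cball ?z0 r \<subseteq> U" using r by (auto simp: subset_iff)
        then have "(\<lambda>t. f (z + t *s v)) holomorphic_on cball t0 d"
          using f line unfolding hol_on_lines_def by (blast intro: holomorphic_on_subset)
        with * show ?case by (intro holomorphic_intros) (auto simp del: of_nat_Suc)
      qed
      then have "\<forall>\<^sub>F n in sequentially. continuous_on (cball t0 d) (\<lambda>t. ?q n (z + t *s v)) \<and>
          (\<lambda>t. ?q n (z + t *s v)) holomorphic_on ball t0 d"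
        by eventually_elim
          (auto intro: holomorphic_on_imp_continuous_on holomorphic_on_subset[OF _ ball_subset_cball])
      then have "(\<lambda>t. cpartial i f (z + t *s v)) holomorphic_on ball t0 d"
        using holomorphic_uniform_limit[OF _ ul] by auto
      then show "\<exists>f'. ((\<lambda>t. cpartial i f (z + t *s v)) has_field_derivative f') (at t0)"
        using d(1) by (auto simp: holomorphic_on_open)
    qed
  qed
qed

lemma has_field_derivative_cpartial:
  assumes "open U" "hol_on_lines U f" "z \<in> U"
  shows "((\<lambda>t. f (z + t *s axis i 1)) has_field_derivative cpartial i f z) (at 0)"
proof -
  have "(\<lambda>t. f (z + t *s axis i 1)) holomorphic_on {t. z + t *s axis i 1 \<in> U}"
    using assms by (simp add: hol_on_lines_def)
  moreover have "0 \<in> {t. z + t *s axis i 1 \<in> U}" using assms by simp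
  ultimately show ?thesis
    unfolding cpartial_def by (rule holomorphic_derivI[OF _ open_complex_line_vimage[OF assms(1)]])
qed

lemma cpartial_cong:
  assumes U: "open U" and eq: "\<And>z. z \<in> U \<Longrightarrow> f z = g z" and z: "z \<in> U"
  shows "cpartial i f z = cpartial i g z"
  unfolding cpartial_def
proof (rule deriv_cong_ev)
  have "\<forall>\<^sub>F t in nhds 0. t \<in> {t. z + t *s axis i 1 \<in> U}"
    using U z by (intro eventually_nhds_in_open open_complex_line_vimage) auto
  then show "\<forall>\<^sub>F t in nhds 0. f (z + t *s axis i 1) = g (z + t *s axis i 1)"
    by eventually_elim (simp add: eq)
qed simp

lemma funpow_cpartial_cong:
  assumes U: "open U" and eq: "\<And>z. z \<in> U \<Longrightarrow> f z = g z" and z: "z \<in> U"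
  shows "(cpartial i ^^ n) f z = (cpartial i ^^ n) g z"
  using z by (induction n arbitrary: z) (auto simp: eq intro: cpartial_cong[OF U])

lemma hol_on_lines_funpow_cpartial:
  "open U \<Longrightarrow> hol_on_lines U f \<Longrightarrow> hol_on_lines U ((cpartial i ^^ n) f)"
  by (induction n) (auto intro: hol_on_lines_cpartial)

lemma hol_on_lines_const: "hol_on_lines U (\<lambda>_. c)"
  by (simp add: hol_on_lines_def)

lemma hol_on_lines_mult: "hol_on_lines U f \<Longrightarrow> hol_on_lines U g \<Longrightarrow> hol_on_lines U (\<lambda>z. f z * g z)"
  by (auto simp: hol_on_lines_def intro!: continuous_intros holomorphic_intros)

lemma hol_on_lines_coordinate: "hol_on_lines U (\<lambda>z. z $ l)"
  by (auto simp: hol_on_lines_def intro!: continuous_intros holomorphic_intros)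

lemma hol_on_lines_power: "hol_on_lines U f \<Longrightarrow> hol_on_lines U (\<lambda>z. f z ^ n)"
  by (induction n) (auto intro: hol_on_lines_const hol_on_lines_mult)

lemma hol_on_lines_prod:
  "(\<And>a. a \<in> A \<Longrightarrow> hol_on_lines U (f a)) \<Longrightarrow> hol_on_lines U (\<lambda>z. \<Prod>a\<in>A. f a z)"
  by (induction A rule: infinite_finite_induct) (auto intro: hol_on_lines_const hol_on_lines_mult)

lemma cpartial_add_scaled:
  assumes "open U" "hol_on_lines U f" "hol_on_lines U g" "z \<in> U"
  shows "cpartial i (\<lambda>w. f w + c * g w) z = cpartial i f z + c * cpartial i g z"
  unfolding cpartial_def[of i "\<lambda>w. f w + c * g w"]
  by (rule DERIV_imp_deriv)
    (intro DERIV_add DERIV_cmult has_field_derivative_cpartial[OF assms(1)] assms)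

lemma cpartial_coordinate_mult:
  assumes "open U" "hol_on_lines U f" "z \<in> U"
  shows "cpartial i (\<lambda>w. w $ l * f w) z = z $ l * cpartial i f z + (if i = l then f z else 0)"
proof -
  have "((\<lambda>t. z $ l + t * axis i 1 $ l) has_field_derivative axis i 1 $ l) (at (0::complex))"
    by (auto intro!: derivative_eq_intros)
  from DERIV_mult[OF this has_field_derivative_cpartial[OF assms, of i]]
  have "((\<lambda>t. (z + t *s axis i 1) $ l * f (z + t *s axis i 1)) has_field_derivative
      (z $ l * cpartial i f z + axis i 1 $ l * f z)) (at 0)"
    by (simp add: algebra_simps)
  then have "cpartial i (\<lambda>w. w $ l * f w) z = z $ l * cpartial i f z + axis i 1 $ l * f z"
    unfolding cpartial_def[of i "\<lambda>w. w $ l * f w"] by (rule DERIV_imp_deriv)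
  then show ?thesis by (simp add: axis_def)
qed

lemma funpow_cpartial_add_scaled:
  assumes U: "open U" and f: "hol_on_lines U f" and g: "hol_on_lines U g" and z: "z \<in> U"
  shows "(cpartial i ^^ n) (\<lambda>w. f w + c * g w) z = (cpartial i ^^ n) f z + c * (cpartial i ^^ n) g z"
  using z
proof (induction n arbitrary: z)
  case (Suc n)
  have "cpartial i ((cpartial i ^^ n) (\<lambda>w. f w + c * g w)) z
      = cpartial i (\<lambda>z. (cpartial i ^^ n) f z + c * (cpartial i ^^ n) g z) z"
    by (rule cpartial_cong[OF U _ Suc.prems]) (rule Suc.IH)
  then show ?case
    using cpartial_add_scaled[OF U hol_on_lines_funpow_cpartial[OF U f]
        hol_on_lines_funpow_cpartial[OF U g] Suc.prems] by simp
qed simp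

lemma funpow_cpartial_other_coordinate_mult:
  assumes U: "open U" and f: "hol_on_lines U f" and z: "z \<in> U" and "i \<noteq> l"
  shows "(cpartial i ^^ n) (\<lambda>w. w $ l * f w) z = z $ l * (cpartial i ^^ n) f z"
  using z
proof (induction n arbitrary: z)
  case (Suc n)
  have "cpartial i ((cpartial i ^^ n) (\<lambda>w. w $ l * f w)) z
      = cpartial i (\<lambda>z. z $ l * (cpartial i ^^ n) f z) z"
    by (rule cpartial_cong[OF U _ Suc.prems]) (rule Suc.IH)
  then show ?case
    using cpartial_coordinate_mult[OF U hol_on_lines_funpow_cpartial[OF U f] Suc.prems] \<open>i \<noteq> l\<close>
    by simp
qed simp

text \<open>Leibniz' rule, in the form of the commutation relation \<open>[\<partial>\<^sup>n, z] = n \<partial>\<^sup>n\<^sup>-\<^sup>1\<close>. For \<open>n = 0\<close> the truncated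
  exponent on the right is harmless, being multiplied by \<open>0\<close>.\<close>
lemma funpow_cpartial_coordinate_mult:
  assumes U: "open U" and f: "hol_on_lines U f" and z: "z \<in> U"
  shows "(cpartial i ^^ n) (\<lambda>w. w $ i * f w) z
    = z $ i * (cpartial i ^^ n) f z + of_nat n * (cpartial i ^^ (n - 1)) f z"
  using z
proof (induction n arbitrary: z)
  case (Suc n)
  note hol = hol_on_lines_funpow_cpartial[OF U f]
  have "cpartial i ((cpartial i ^^ n) (\<lambda>w. w $ i * f w)) z
      = cpartial i (\<lambda>z. z $ i * (cpartial i ^^ n) f z + of_nat n * (cpartial i ^^ (n - 1)) f z) z"
    by (rule cpartial_cong[OF U _ Suc.prems]) (rule Suc.IH)
  also have "\<dots> = z $ i * (cpartial i ^^ Suc n) f z + (cpartial i ^^ n) f z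
      + of_nat n * cpartial i ((cpartial i ^^ (n - 1)) f) z"
    by (simp add: cpartial_add_scaled[OF U hol_on_lines_mult[OF hol_on_lines_coordinate hol] hol Suc.prems]
        cpartial_coordinate_mult[OF U hol Suc.prems])
  also have "of_nat n * cpartial i ((cpartial i ^^ (n - 1)) f) z = of_nat n * (cpartial i ^^ n) f z"
    by (cases n) auto
  finally show ?case by (simp add: algebra_simps)
qed simp

section \<open>Iterated derivatives in the normal directions\<close>

text \<open>The iterated derivative over an arbitrary list of directions, which makes the fold in
  \<open>multi_partial\<close> accessible to induction.\<close>
definition iter_partial ::
  "('d \<Rightarrow> nat) \<Rightarrow> 'd list \<Rightarrow> (complex ^ ('d::finite + 'e::finite) \<Rightarrow> complex) \<Rightarrow>
   complex ^ ('d + 'e) \<Rightarrow> complex" where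
  "iter_partial \<alpha> xs f = foldr (\<lambda>i. cpartial (Inl i) ^^ \<alpha> i) xs f"

lemma iter_partial_simps [simp]:
  "iter_partial \<alpha> [] f = f"
  "iter_partial \<alpha> (x # xs) f = (cpartial (Inl x) ^^ \<alpha> x) (iter_partial \<alpha> xs f)"
  by (simp_all add: iter_partial_def)

lemma iter_partial_cong:
  assumes U: "open U" and eq: "\<And>z. z \<in> U \<Longrightarrow> f z = g z" and z: "z \<in> U"
  shows "iter_partial \<alpha> xs f z = iter_partial \<alpha> xs g z"
  using z by (induction xs arbitrary: z) (auto simp: eq intro: funpow_cpartial_cong[OF U])

lemma iter_partial_cong_index:
  "(\<And>i. i \<in> set xs \<Longrightarrow> \<alpha> i = \<beta> i) \<Longrightarrow> iter_partial \<alpha> xs f = iter_partial \<beta> xs f"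
  by (induction xs) auto

lemma hol_on_lines_iter_partial:
  "open U \<Longrightarrow> hol_on_lines U f \<Longrightarrow> hol_on_lines U (iter_partial \<alpha> xs f)"
  by (induction xs) (auto intro: hol_on_lines_funpow_cpartial)

lemma iter_partial_other_coordinate_mult:
  assumes U: "open U" and f: "hol_on_lines U f" and z: "z \<in> U" and "l \<notin> Inl ` set xs"
  shows "iter_partial \<alpha> xs (\<lambda>w. w $ l * f w) z = z $ l * iter_partial \<alpha> xs f z"
  using z assms(4)
proof (induction xs arbitrary: z)
  case (Cons x xs)
  have "(cpartial (Inl x) ^^ \<alpha> x) (iter_partial \<alpha> xs (\<lambda>w. w $ l * f w)) z
      = (cpartial (Inl x) ^^ \<alpha> x) (\<lambda>z. z $ l * iter_partial \<alpha> xs f z) z"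
    by (rule funpow_cpartial_cong[OF U _ Cons.prems(1)]) (use Cons in auto)
  then show ?case
    using funpow_cpartial_other_coordinate_mult[OF U hol_on_lines_iter_partial[OF U f] Cons.prems(1)]
      Cons.prems(2) by auto
qed simp

text \<open>In a list without repetitions, all derivatives in direction \<open>i\<close> are taken in one block, so
  Leibniz' rule can be applied there without interchanging partial derivatives.\<close>
lemma iter_partial_coordinate_mult:
  assumes U: "open U" and f: "hol_on_lines U f" and z: "z \<in> U" and "i \<in> set xs" "distinct xs"
  shows "iter_partial \<alpha> xs (\<lambda>w. w $ Inl i * f w) z
    = z $ Inl i * iter_partial \<alpha> xs f z + of_nat (\<alpha> i) * iter_partial (\<alpha>(i := \<alpha> i - 1)) xs f z"
  using z assms(4,5)
proof (induction xs arbitrary: z)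
  case (Cons x xs)
  note hol = hol_on_lines_iter_partial[OF U f]
  show ?case
  proof (cases "x = i")
    case True
    then have ni: "i \<notin> set xs" using Cons.prems by auto
    have low: "iter_partial (\<alpha>(i := \<alpha> i - 1)) xs f = iter_partial \<alpha> xs f"
      using ni by (intro iter_partial_cong_index) auto
    have "(cpartial (Inl i) ^^ \<alpha> i) (iter_partial \<alpha> xs (\<lambda>w. w $ Inl i * f w)) z
        = (cpartial (Inl i) ^^ \<alpha> i) (\<lambda>z. z $ Inl i * iter_partial \<alpha> xs f z) z"
      by (rule funpow_cpartial_cong[OF U _ Cons.prems(1)])
        (use ni in \<open>auto intro: iter_partial_other_coordinate_mult[OF U f]\<close>)
    then show ?thesis
      by (simp only: True iter_partial_simps low fun_upd_same
          funpow_cpartial_coordinate_mult[OF U hol Cons.prems(1)])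
  next
    case False
    have "(cpartial (Inl x) ^^ \<alpha> x) (iter_partial \<alpha> xs (\<lambda>w. w $ Inl i * f w)) z
        = (cpartial (Inl x) ^^ \<alpha> x) (\<lambda>z. z $ Inl i * iter_partial \<alpha> xs f z
            + of_nat (\<alpha> i) * iter_partial (\<alpha>(i := \<alpha> i - 1)) xs f z) z"
      by (rule funpow_cpartial_cong[OF U _ Cons.prems(1)], rule Cons.IH)
        (use Cons.prems False in auto)
    then show ?thesis
      by (simp only: iter_partial_simps fun_upd_other[OF False] sum.inject False simp_thms
          funpow_cpartial_add_scaled[OF U hol_on_lines_mult[OF hol_on_lines_coordinate hol] hol Cons.prems(1)]
          funpow_cpartial_other_coordinate_mult[OF U hol Cons.prems(1)])
  qed
qed simp

lemma multi_partial_eq_iter_partial: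
  "multi_partial \<alpha> f = iter_partial \<alpha> (sorted_list_of_set UNIV) f"
  by (simp add: multi_partial_def iter_partial_def)

lemma multi_partial_cong:
  assumes "open U" "\<And>z. z \<in> U \<Longrightarrow> f z = g z" "z \<in> U"
  shows "multi_partial \<alpha> f z = multi_partial \<alpha> g z"
  unfolding multi_partial_eq_iter_partial by (rule iter_partial_cong) (use assms in auto)

lemma multi_partial_mult_Inr:
  assumes "open U" "hol_on_lines U f" "z \<in> U"
  shows "multi_partial \<alpha> (\<lambda>w. w $ Inr j * f w) z = z $ Inr j * multi_partial \<alpha> f z"
  unfolding multi_partial_eq_iter_partial
  by (rule iter_partial_other_coordinate_mult) (use assms in auto)

text \<open>On the zero set of the normal coordinates, multiplying by a normal coordinate only shifts
  derivatives. Hence it raises the order of vanishing by one, and the jets of monomials can be computed by recursion.\<close>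
lemma multi_partial_mult_Inl:
  assumes "open U" "hol_on_lines U f" "z \<in> U" "z $ Inl i = 0"
  shows "multi_partial \<alpha> (\<lambda>w. w $ Inl i * f w) z
    = of_nat (\<alpha> i) * multi_partial (\<alpha>(i := \<alpha> i - 1)) f z"
  unfolding multi_partial_eq_iter_partial
  by (subst iter_partial_coordinate_mult[OF assms(1-3)]) (use assms in auto)

lemma funpow_cpartial_const: "(cpartial i ^^ n) (\<lambda>_. c) = (\<lambda>_. if n = 0 then c else 0)"
  by (induction n) (auto simp: cpartial_def fun_eq_iff)

lemma multi_partial_const: "multi_partial \<alpha> (\<lambda>_. c) = (\<lambda>_. if \<alpha> = (\<lambda>_. 0) then c else 0)"
proof -
  have iter: "iter_partial \<alpha> xs (\<lambda>_. c) = (\<lambda>_. if \<forall>i\<in>set xs. \<alpha> i = 0 then c else 0)" for xs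
    by (induction xs) (auto simp: funpow_cpartial_const)
  have "(\<forall>i\<in>set (sorted_list_of_set UNIV). \<alpha> i = 0) \<longleftrightarrow> \<alpha> = (\<lambda>_. 0)" by auto
  then show ?thesis unfolding multi_partial_eq_iter_partial iter by simp
qed


section \<open>Normal monomials\<close>

definition normal_monomial :: "('d::finite \<Rightarrow> nat) \<Rightarrow> complex ^ ('d + 'e::finite) \<Rightarrow> complex" where
  "normal_monomial \<alpha> z = (\<Prod>i\<in>UNIV. (z $ Inl i) ^ \<alpha> i)"

lemma hol_on_lines_normal_monomial: "hol_on_lines U (normal_monomial \<alpha>)"
  unfolding normal_monomial_def[abs_def]
  by (intro hol_on_lines_prod hol_on_lines_power hol_on_lines_coordinate)

lemma normal_monomial_step:
  assumes "\<alpha> i > 0"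
  shows "normal_monomial \<alpha> z = z $ Inl i * normal_monomial (\<alpha>(i := \<alpha> i - 1)) z"
proof -
  have "(\<Prod>l\<in>UNIV - {i}. (z $ Inl l) ^ \<alpha> l) = (\<Prod>l\<in>UNIV - {i}. (z $ Inl l) ^ (\<alpha>(i := \<alpha> i - 1)) l)"
    by (rule prod.cong) auto
  moreover have "(z $ Inl i) ^ \<alpha> i = z $ Inl i * (z $ Inl i) ^ (\<alpha> i - 1)"
    using power_minus_mult[OF assms, of "z $ Inl i"] by (simp add: mult.commute)
  ultimately show ?thesis
    unfolding normal_monomial_def by (simp add: prod.remove[of UNIV i] mult.assoc)
qed

lemma multi_partial_normal_monomial:
  assumes z: "\<And>i. z $ Inl i = 0"
  shows "multi_partial \<beta> (normal_monomial \<alpha>) z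
    = (if \<beta> = \<alpha> then \<Prod>i\<in>UNIV. fact (\<alpha> i) else 0)"
proof (induction "\<Sum>i\<in>UNIV. \<alpha> i" arbitrary: \<alpha> \<beta>)
  case 0
  then have \<alpha>: "\<alpha> = (\<lambda>_. 0)" by auto
  then have one: "normal_monomial \<alpha> = (\<lambda>_. 1)" by (auto simp: normal_monomial_def)
  show ?case unfolding one multi_partial_const using \<alpha> by auto
next
  case (Suc n)
  then obtain i where i: "\<alpha> i > 0" by (metis gr0I sum.neutral nat.distinct(1))
  let ?\<alpha>' = "\<alpha>(i := \<alpha> i - 1)" and ?\<beta>' = "\<beta>(i := \<beta> i - 1)"
  have "sum \<alpha> (UNIV - {i}) = sum ?\<alpha>' (UNIV - {i})" by (rule sum.cong) auto
  then have n: "n = sum ?\<alpha>' UNIV"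
    using Suc.hyps(2) i by (simp add: sum.remove[of UNIV i])
  have eq: "normal_monomial \<alpha> = (\<lambda>w. w $ Inl i * normal_monomial ?\<alpha>' w)"
    using normal_monomial_step[of \<alpha> i, OF i] by auto
  have "multi_partial \<beta> (normal_monomial \<alpha>) z
      = of_nat (\<beta> i) * multi_partial ?\<beta>' (normal_monomial ?\<alpha>') z"
    unfolding eq by (rule multi_partial_mult_Inl[OF open_UNIV hol_on_lines_normal_monomial UNIV_I z])
  also have "\<dots> = of_nat (\<beta> i) * (if ?\<beta>' = ?\<alpha>' then \<Prod>l\<in>UNIV. fact (?\<alpha>' l) else 0)"
    by (simp only: Suc.hyps(1)[OF n])
  also have "\<dots> = (if \<beta> = \<alpha> then \<Prod>l\<in>UNIV. fact (\<alpha> l) else 0)"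
  proof (cases "\<beta> = \<alpha>")
    case True
    have "(\<Prod>l\<in>UNIV - {i}. fact (?\<alpha>' l)) = (\<Prod>l\<in>UNIV - {i}. fact (\<alpha> l) :: complex)"
      by (rule prod.cong) auto
    then have "of_nat (\<alpha> i) * (\<Prod>l\<in>UNIV. fact (?\<alpha>' l)) = (\<Prod>l\<in>UNIV. fact (\<alpha> l) :: complex)"
      using i by (simp add: prod.remove[of UNIV i] fact_reduce[of "\<alpha> i"])
    then show ?thesis using True by simp
  next
    case False
    have "\<beta> i = 0 \<or> ?\<beta>' \<noteq> ?\<alpha>'"
    proof (rule ccontr)
      assume "\<not> ?thesis"
      then have "\<beta> i > 0" "?\<beta>' = ?\<alpha>'" by auto
      then have pos: "\<beta> i > 0" and upd: "?\<beta>' l = ?\<alpha>' l" for l by (simp_all only:)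
      have "\<beta> l = \<alpha> l" for l
        using upd[of l] pos i by (cases "l = i") auto
      then show False using False by auto
    qed
    then show ?thesis using False by auto
  qed
  finally show ?case .
qed

lemma finite_A_indices: "finite (A_indices k :: ('d::finite \<Rightarrow> nat) set)"
proof (rule finite_subset)
  have "\<alpha> i < k" if "sum \<alpha> UNIV < k" for \<alpha> :: "'d \<Rightarrow> nat" and i
    using order_le_less_trans[OF member_le_sum[of i UNIV \<alpha>] that] by auto
  then show "A_indices k \<subseteq> (UNIV :: 'd set) \<rightarrow>\<^sub>E {..<k}"
    by (auto simp: A_indices_def)
qed (simp add: finite_PiE)

section \<open>Boundedness of derivative functionals\<close>

text \<open>Keeping the function and the functional aspect together makes the notion stable under partial
  derivatives.\<close>
definition hol_functional_family ::
  "(complex ^ 'n::finite) set \<Rightarrow> ('h::complex_hilbert \<Rightarrow> complex ^ 'n \<Rightarrow> complex) \<Rightarrow> bool" where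
  "hol_functional_family U F \<longleftrightarrow>
     (\<forall>h. hol_on_lines U (F h)) \<and>
     (\<forall>z\<in>U. bounded_linear (\<lambda>h. F h z)) \<and>
     (\<forall>z\<in>U. \<forall>c h. F (c *\<^sub>C h) z = c * F h z)"

text \<open>The functional \<open>h \<mapsto> \<partial>\<^sub>i (F h) z\<close> is a pointwise limit of difference quotients of bounded
  functionals, hence bounded by Banach and Steinhaus.\<close>
lemma hol_functional_family_cpartial:
  fixes F :: "'h::complex_hilbert \<Rightarrow> complex ^ 'n::finite \<Rightarrow> complex"
  assumes U: "open U" and F: "hol_functional_family U F"
  shows "hol_functional_family U (\<lambda>h. cpartial i (F h))"
proof -
  have hol: "hol_on_lines U (F h)" for h
    using F by (simp add: hol_functional_family_def)
  have bl: "bounded_linear (\<lambda>h. F h z)" if "z \<in> U" for z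
    using F that by (simp add: hol_functional_family_def)
  have hom: "F (c *\<^sub>C h) z = c * F h z" if "z \<in> U" for c h z
    using F that by (simp add: hol_functional_family_def)
  let ?e = "\<lambda>n. inverse (of_nat (Suc n)) :: complex"
  have "bounded_linear (\<lambda>h. cpartial i (F h) z)" if z: "z \<in> U" for z
  proof -
    have lim: "(\<lambda>n. (F h (z + ?e n *s axis i 1) - F h z) / ?e n) \<longlonglongrightarrow> cpartial i (F h) z" for h
    proof -
      obtain r where r: "r > 0" and ul: "uniform_limit (cball z r)
          (\<lambda>n z. (F h (z + ?e n *s axis i 1) - F h z) / ?e n) (cpartial i (F h)) sequentially"
        using cpartial_uniform_limit[OF U hol z, of h i] by blast
      show ?thesis by (rule tendsto_uniform_limitI[OF ul]) (use r in simp)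
    qed
    have "(\<lambda>n. z + ?e n *s axis i 1) \<longlonglongrightarrow> z + 0 *s axis i 1"
    proof (intro tendsto_add tendsto_const bounded_linear.tendsto[OF bounded_linear_complex_line])
      show "?e \<longlonglongrightarrow> 0" by (rule LIMSEQ_Suc[OF lim_inverse_n])
    qed
    then have "\<forall>\<^sub>F n in sequentially. z + ?e n *s axis i 1 \<in> U"
      using U z by (intro topological_tendstoD) auto
    \<comment> \<open>Only the quotients whose shifted point lies in \<open>U\<close> are known to be bounded functionals.\<close>
    then obtain N where N: "\<And>n. n \<ge> N \<Longrightarrow> z + ?e n *s axis i 1 \<in> U"
      by (auto simp: eventually_sequentially)
    show ?thesis
    proof (rule Banach_Steinhaus_pointwise_limit)
      fix n
      show "bounded_linear (\<lambda>h. (F h (z + ?e (n + N) *s axis i 1) - F h z) / ?e (n + N))"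
        by (intro bounded_linear_compose[OF bounded_linear_divide] bounded_linear_sub bl z N) simp
      show "(\<lambda>n. (F h (z + ?e (n + N) *s axis i 1) - F h z) / ?e (n + N)) \<longlonglongrightarrow> cpartial i (F h) z" for h
        using LIMSEQ_ignore_initial_segment[OF lim[of h], of N] .
    qed
  qed
  moreover have "cpartial i (F (c *\<^sub>C h)) z = c * cpartial i (F h) z" if z: "z \<in> U" for c h z
  proof -
    have "cpartial i (F (c *\<^sub>C h)) z = cpartial i (\<lambda>z. c * F h z) z"
      by (rule cpartial_cong[OF U _ z]) (simp add: hom)
    also have "\<dots> = c * cpartial i (F h) z"
      unfolding cpartial_def[of i "\<lambda>z. c * F h z"]
      by (intro DERIV_imp_deriv DERIV_cmult has_field_derivative_cpartial[OF U hol z])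
    finally show ?thesis .
  qed
  ultimately show ?thesis
    using hol_on_lines_cpartial[OF U hol] by (simp add: hol_functional_family_def)
qed

lemma hol_functional_family_multi_partial:
  assumes U: "open U" and F: "hol_functional_family U F"
  shows "hol_functional_family U (\<lambda>h. multi_partial \<alpha> (F h))"
proof -
  have pow: "hol_functional_family U (\<lambda>h. (cpartial i ^^ n) (G h))"
    if "hol_functional_family U G" for G :: "'c \<Rightarrow> _" and i n
    using that by (induction n) (auto intro: hol_functional_family_cpartial[OF U])
  have "hol_functional_family U (\<lambda>h. iter_partial \<alpha> xs (F h))" for xs
    by (induction xs) (auto simp: F intro: pow)
  then show ?thesis by (simp add: multi_partial_eq_iter_partial)
qed

section \<open>Coordinates along the subvariety\<close>

lemma coordinate_in_alg_A: "(\<lambda>z. z $ i) \<in> alg_A \<Omega>"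
proof -
  have "holomorphic_several (\<lambda>z::complex ^ 'a. z $ i) UNIV"
    unfolding holomorphic_several_def
    by (auto intro!: exI[of _ "\<lambda>v. v $ i"] bounded_linear_imp_has_derivative bounded_linear_vec_nth)
  then show ?thesis
    unfolding alg_A_def by (auto intro!: exI[of _ UNIV] exI[of _ "\<lambda>z. z $ i"])
qed

lemma sum_over_sum_type:
  "(\<Sum>i\<in>(UNIV :: ('d::finite + 'e::finite) set). f i) = (\<Sum>i\<in>UNIV. f (Inl i)) + (\<Sum>j\<in>UNIV. f (Inr j))"
  by (simp add: UNIV_Plus_UNIV[symmetric] sum.Plus del: UNIV_Plus_UNIV)

lemma polynomial_several_normal_monomial:
  "polynomial_several (normal_monomial \<alpha> :: complex ^ ('d::finite + 'e::finite) \<Rightarrow> complex)"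
proof -
  have "(\<Prod>i\<in>UNIV. (z $ i) ^ case_sum \<alpha> (\<lambda>_. 0) i) = normal_monomial \<alpha> z"
    for z :: "complex ^ ('d + 'e)"
    by (simp add: UNIV_Plus_UNIV[symmetric] prod.Plus normal_monomial_def del: UNIV_Plus_UNIV)
  then show ?thesis
    unfolding polynomial_several_def
    by (intro exI[of _ "{case_sum \<alpha> (\<lambda>_. 0)}"] exI[of _ "\<lambda>_. 1"]) auto
qed

definition Z_embed :: "complex ^ 'e \<Rightarrow> complex ^ ('d::finite + 'e::finite)" where
  "Z_embed w = (\<chi> i. case i of Inl _ \<Rightarrow> 0 | Inr j \<Rightarrow> w $ j)"

lemma Z_embed_nth [simp]: "Z_embed w $ Inl i = 0" "Z_embed w $ Inr j = w $ j"
  by (simp_all add: Z_embed_def)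

lemma Z_embed_coords:
  assumes "z \<in> Z_set \<Omega>"
  shows "Z_embed (\<chi> j. z $ Inr j) = z"
  using assms by (auto simp: Z_set_def Z_embed_def vec_eq_iff split: sum.split)

lemma Z_coords_iff: "w \<in> Z_coords \<Omega> \<longleftrightarrow> Z_embed w \<in> \<Omega>"
proof
  assume "w \<in> Z_coords \<Omega>"
  then obtain z where "z \<in> Z_set \<Omega>" "w = (\<chi> j. z $ Inr j)" by (auto simp: Z_coords_def)
  then show "Z_embed w \<in> \<Omega>" by (simp add: Z_embed_coords) (simp add: Z_set_def)
next
  assume "Z_embed w \<in> \<Omega>"
  then show "w \<in> Z_coords \<Omega>"
    by (auto simp: Z_coords_def Z_set_def vec_eq_iff intro!: image_eqI[of _ _ "Z_embed w"])
qed

lemma Z_set_eq: "Z_set \<Omega> = Z_embed ` Z_coords \<Omega>"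
proof
  show "Z_set \<Omega> \<subseteq> Z_embed ` Z_coords \<Omega>"
    using Z_embed_coords by (force simp: Z_coords_def)
  show "Z_embed ` Z_coords \<Omega> \<subseteq> Z_set \<Omega>"
    by (auto simp: Z_coords_iff Z_set_def)
qed

lemma open_Z_coords:
  fixes \<Omega> :: "(complex ^ ('d::finite + 'e::finite)) set"
  assumes "open \<Omega>"
  shows "open (Z_coords \<Omega>)"
proof -
  have "continuous_on UNIV (Z_embed :: complex ^ 'e \<Rightarrow> complex ^ ('d + 'e))"
    unfolding Z_embed_def[abs_def]
  proof (rule continuous_on_vec_lambda)
    fix i :: "'d + 'e"
    show "continuous_on UNIV (\<lambda>w::complex ^ 'e. case i of Inl _ \<Rightarrow> 0 | Inr j \<Rightarrow> w $ j)"
      by (cases i) (auto intro: continuous_intros)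
  qed
  from open_vimage[OF assms this] show ?thesis
    by (simp add: vimage_def Z_coords_iff[symmetric])
qed

section \<open>Jets and the quotient module\<close>

locale gleason_module =
  fixes \<Omega> :: "(complex ^ ('d::{finite,linorder} + 'e::finite)) set"
    and ev :: "'h::complex_hilbert \<Rightarrow> complex ^ ('d + 'e) \<Rightarrow> complex ^ 'r::finite"
  assumes open_domain: "open \<Omega>"
    and module: "rk_hilbert_module \<Omega> ev"
    and polynomials: "contains_polynomials \<Omega> ev"
    and gleason: "gleason_property \<Omega> ev"
begin

lemma ev_eqI: "(\<And>z. z \<in> \<Omega> \<Longrightarrow> ev g z = ev h z) \<Longrightarrow> g = h"
  using module unfolding rk_hilbert_module_def by blast

lemma bounded_linear_ev: "z \<in> \<Omega> \<Longrightarrow> bounded_linear (\<lambda>h. ev h z)"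
  using module unfolding rk_hilbert_module_def by blast

lemma ev_scaleC: "z \<in> \<Omega> \<Longrightarrow> ev (c *\<^sub>C h) z = c *s ev h z"
  using module unfolding rk_hilbert_module_def by blast

lemma ev_add: "z \<in> \<Omega> \<Longrightarrow> ev (g + h) z = ev g z + ev h z"
  using linear_add[OF bounded_linear.linear[OF bounded_linear_ev]] .

lemma ev_diff: "z \<in> \<Omega> \<Longrightarrow> ev (g - h) z = ev g z - ev h z"
  using linear_diff[OF bounded_linear.linear[OF bounded_linear_ev]] .

lemma ev_sum: "z \<in> \<Omega> \<Longrightarrow> ev (\<Sum>i\<in>I. f i) z = (\<Sum>i\<in>I. ev (f i) z)"
  using linear_sum[OF bounded_linear.linear[OF bounded_linear_ev]] .

abbreviation M :: "'d + 'e \<Rightarrow> 'h \<Rightarrow> 'h" where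
  "M \<equiv> coord_mult \<Omega> ev"

lemma ev_M:
  assumes "z \<in> \<Omega>"
  shows "ev (M i h) z = z $ i *s ev h z"
proof -
  have "\<forall>f\<in>alg_A \<Omega>. \<forall>h. \<exists>g. \<forall>z\<in>\<Omega>. ev g z = f z *s ev h z"
    using module unfolding rk_hilbert_module_def by (elim conjE)
  from this[THEN bspec, OF coordinate_in_alg_A, THEN spec]
  have "\<exists>g. \<forall>z\<in>\<Omega>. ev g z = z $ i *s ev h z" .
  then have "\<exists>!g. \<forall>z\<in>\<Omega>. ev g z = z $ i *s ev h z"
    by (rule ex_ex1I) (rule ev_eqI, simp)
  from theI'[OF this] show ?thesis
    using assms unfolding coord_mult_def module_mult_def by blast
qed

lemma M_add: "M i (g + h) = M i g + M i h"
  by (rule ev_eqI) (simp add: ev_M ev_add vector_add_ldistrib)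

lemma M_scaleC: "M i (c *\<^sub>C h) = c *\<^sub>C M i h"
  by (rule ev_eqI) (simp add: ev_M ev_scaleC mult.commute)

lemma M_commute: "M i (M j h) = M j (M i h)"
  by (rule ev_eqI) (simp add: ev_M mult.commute)

lemma M_scaleR: "M i (c *\<^sub>R h) = c *\<^sub>R M i h"
  by (simp add: scaleC_of_real[symmetric] M_scaleC)

text \<open>Continuity of the action at the pair of the coordinate function and \<open>0\<close>, tested with the
  coordinate function kept fixed.\<close>
lemma bounded_linear_M: "bounded_linear (M i)"
proof -
  have M0: "M i 0 = 0" using M_scaleR[of i 0 0] by simp
  have "\<forall>f\<in>alg_A \<Omega>. \<forall>h. \<forall>\<epsilon>>0. \<exists>\<delta>>0. \<forall>f'\<in>alg_A \<Omega>. \<forall>h'.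
      (\<forall>z\<in>closure \<Omega>. cmod (f' z - f z) < \<delta>) \<and> norm (h' - h) < \<delta> \<longrightarrow>
      norm (module_mult \<Omega> ev f' h' - module_mult \<Omega> ev f h) < \<epsilon>"
    using module unfolding rk_hilbert_module_def by (elim conjE)
  from this[rule_format, OF coordinate_in_alg_A[of i] zero_less_one, of 0]
  obtain \<delta> where \<delta>: "\<delta> > 0" and small: "\<And>f' h'. f' \<in> alg_A \<Omega> \<Longrightarrow>
      (\<forall>z\<in>closure \<Omega>. cmod (f' z - z $ i) < \<delta>) \<and> norm (h' - 0) < \<delta> \<Longrightarrow>
      norm (module_mult \<Omega> ev f' h' - module_mult \<Omega> ev (\<lambda>z. z $ i) 0) < 1"
    by blast
  have small_M: "norm (M i h) < 1" if "norm h < \<delta>" for h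
    using small[OF coordinate_in_alg_A[of i \<Omega>], of h] that \<delta> M0 by (simp add: coord_mult_def)
  show ?thesis
  proof (rule bounded_linear_intro[where K = "2 / \<delta>"])
    fix h
    show "norm (M i h) \<le> norm h * (2 / \<delta>)"
    proof (cases "h = 0")
      case False
      have "norm (M i ((\<delta> / 2 / norm h) *\<^sub>R h)) < 1"
        by (rule small_M) (use False \<delta> in simp)
      then have "\<delta> / 2 / norm h * norm (M i h) < 1"
        using \<delta> by (simp add: M_scaleR)
      then show ?thesis using False \<delta> by (simp add: field_simps)
    qed (simp add: M0)
  qed (simp_all add: M_add M_scaleR)
qed

lemma M_diff: "M i (g - h) = M i g - M i h"
  by (rule linear_diff[OF bounded_linear.linear[OF bounded_linear_M]])

lemma M_sum: "M i (\<Sum>j\<in>I. f j) = (\<Sum>j\<in>I. M i (f j))"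
  by (rule linear_sum[OF bounded_linear.linear[OF bounded_linear_M]])

lemma hol_functional_family_component: "hol_functional_family \<Omega> (\<lambda>h z. ev h z $ j)"
  unfolding hol_functional_family_def
proof (intro conjI allI ballI)
  show "hol_on_lines \<Omega> (\<lambda>z. ev h z $ j)" for h
    using module unfolding rk_hilbert_module_def
    by (intro holomorphic_several_imp_hol_on_lines open_domain) blast
  show "bounded_linear (\<lambda>h. ev h z $ j)" if "z \<in> \<Omega>" for z
    by (rule bounded_linear_compose[OF bounded_linear_vec_nth bounded_linear_ev[OF that]])
qed (simp add: ev_scaleC)

lemma hol_on_lines_component: "hol_on_lines \<Omega> (\<lambda>z. ev h z $ j)"
  using hol_functional_family_component by (simp add: hol_functional_family_def)

text \<open>These are joint eigenfunctionals of the tangential multiplications, because tangential coordinates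
  are constants for normal derivatives.\<close>
definition jet :: "complex ^ 'e \<Rightarrow> ('d \<Rightarrow> nat) \<times> 'r \<Rightarrow> 'h \<Rightarrow> complex" where
  "jet w a h = multi_partial (fst a) (\<lambda>z. ev h z $ snd a) (Z_embed w)"

lemma
  assumes "w \<in> Z_coords \<Omega>"
  shows bounded_linear_jet: "bounded_linear (jet w a)"
    and jet_scaleC: "jet w a (c *\<^sub>C h) = c * jet w a h"
proof -
  have "hol_functional_family \<Omega> (\<lambda>h. multi_partial (fst a) (\<lambda>z. ev h z $ snd a))"
    by (intro hol_functional_family_multi_partial open_domain hol_functional_family_component)
  then show "bounded_linear (jet w a)" "jet w a (c *\<^sub>C h) = c * jet w a h"
    using assms unfolding hol_functional_family_def jet_def[abs_def] Z_coords_iff by blast+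
qed

lemma jet_add: "w \<in> Z_coords \<Omega> \<Longrightarrow> jet w a (g + h) = jet w a g + jet w a h"
  using linear_add[OF bounded_linear.linear[OF bounded_linear_jet]] .

lemma jet_zero: "w \<in> Z_coords \<Omega> \<Longrightarrow> jet w a 0 = 0"
  using linear_0[OF bounded_linear.linear[OF bounded_linear_jet]] .

lemma jet_M_Inr:
  assumes w: "w \<in> Z_coords \<Omega>"
  shows "jet w a (M (Inr l) h) = w $ l * jet w a h"
proof -
  have "jet w a (M (Inr l) h) = multi_partial (fst a) (\<lambda>z. z $ Inr l * ev h z $ snd a) (Z_embed w)"
    unfolding jet_def by (rule multi_partial_cong[OF open_domain])
      (use w in \<open>simp_all add: ev_M Z_coords_iff\<close>)
  then show ?thesis
    using w by (simp add: jet_def multi_partial_mult_Inr[OF open_domain hol_on_lines_component] Z_coords_iff)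
qed

lemma jet_M_Inl:
  assumes w: "w \<in> Z_coords \<Omega>"
  shows "jet w (\<alpha>, j) (M (Inl i) h) = of_nat (\<alpha> i) * jet w (\<alpha>(i := \<alpha> i - 1), j) h"
proof -
  have "jet w (\<alpha>, j) (M (Inl i) h) = multi_partial \<alpha> (\<lambda>z. z $ Inl i * ev h z $ j) (Z_embed w)"
    unfolding jet_def fst_conv snd_conv by (rule multi_partial_cong[OF open_domain])
      (use w in \<open>simp_all add: ev_M Z_coords_iff\<close>)
  also have "\<dots> = of_nat (\<alpha> i) * multi_partial (\<alpha>(i := \<alpha> i - 1)) (\<lambda>z. ev h z $ j) (Z_embed w)"
    by (rule multi_partial_mult_Inl[OF open_domain hol_on_lines_component])
      (use w in \<open>simp_all add: Z_coords_iff\<close>)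
  finally show ?thesis by (simp add: jet_def)
qed

lemma submodule_M0_eq_jets:
  "submodule_M0 \<Omega> k ev = {h. \<forall>w\<in>Z_coords \<Omega>. \<forall>a\<in>A_indices k \<times> UNIV. jet w a h = 0}"
  unfolding submodule_M0_def jet_def Z_set_eq by auto

lemma subspace_submodule_M0: "complex_vector.subspace (submodule_M0 \<Omega> k ev)"
  by (auto simp: complex_vector.subspace_def submodule_M0_eq_jets jet_zero jet_add jet_scaleC)

lemma M_Inl_submodule_M0:
  assumes "g \<in> submodule_M0 \<Omega> k ev"
  shows "M (Inl i) g \<in> submodule_M0 \<Omega> (Suc k) ev"
proof -
  have "jet w (\<alpha>, j) (M (Inl i) g) = 0"
    if w: "w \<in> Z_coords \<Omega>" and \<alpha>: "\<alpha> \<in> A_indices (Suc k)" for w \<alpha> j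
  proof (cases "\<alpha> i = 0")
    case False
    have "sum \<alpha> (UNIV - {i}) = sum (\<alpha>(i := \<alpha> i - 1)) (UNIV - {i})" by (rule sum.cong) auto
    then have "sum (\<alpha>(i := \<alpha> i - 1)) UNIV < sum \<alpha> UNIV"
      using False by (simp add: sum.remove[of UNIV i])
    then have "\<alpha>(i := \<alpha> i - 1) \<in> A_indices k"
      using \<alpha> by (simp add: A_indices_def)
    then show ?thesis
      using assms w by (simp add: jet_M_Inl submodule_M0_eq_jets)
  qed (simp add: jet_M_Inl w)
  then show ?thesis by (auto simp: submodule_M0_eq_jets)
qed

text \<open>It exists because the module contains the polynomials, and it is unique because elements are
  determined by their values.\<close>
definition monomial :: "('d \<Rightarrow> nat) \<Rightarrow> 'r \<Rightarrow> 'h" where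
  "monomial \<alpha> j = (SOME h. \<forall>z\<in>\<Omega>. ev h z = axis j (normal_monomial \<alpha> z))"

lemma ev_monomial:
  assumes "z \<in> \<Omega>"
  shows "ev (monomial \<alpha> j) z = axis j (normal_monomial \<alpha> z)"
proof -
  have "polynomial_several (\<lambda>z. axis j (normal_monomial \<alpha> z) $ l)" for l
  proof (cases "l = j")
    case True
    then show ?thesis using polynomial_several_normal_monomial[of \<alpha>] by (simp add: axis_def)
  next
    case False
    have "polynomial_several (\<lambda>_. 0)"
      unfolding polynomial_several_def by (intro exI[of _ "{}"]) auto
    then show ?thesis using False by (simp add: axis_def)
  qed
  then have "\<exists>h. \<forall>z\<in>\<Omega>. ev h z = axis j (normal_monomial \<alpha> z)"
    by (intro polynomials[unfolded contains_polynomials_def, THEN spec, THEN mp] allI)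
  from someI_ex[OF this] show ?thesis using assms by (simp add: monomial_def)
qed

lemma M_Inl_monomial: "M (Inl i) (monomial \<alpha> j) = monomial (\<alpha>(i := \<alpha> i + 1)) j"
proof (rule ev_eqI)
  fix z assume "z \<in> \<Omega>"
  then show "ev (M (Inl i) (monomial \<alpha> j)) z = ev (monomial (\<alpha>(i := \<alpha> i + 1)) j) z"
    using normal_monomial_step[of "\<alpha>(i := \<alpha> i + 1)" i z]
    by (simp add: ev_M ev_monomial vec_eq_iff axis_def)
qed

lemma jet_monomial:
  assumes w: "w \<in> Z_coords \<Omega>"
  shows "jet w a (monomial \<alpha> j) = (if a = (\<alpha>, j) then \<Prod>i\<in>UNIV. fact (\<alpha> i) else 0)"
proof -
  have "jet w a (monomial \<alpha> j) = multi_partial (fst a) (\<lambda>z. axis j (normal_monomial \<alpha> z) $ snd a) (Z_embed w)"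
    unfolding jet_def by (rule multi_partial_cong[OF open_domain])
      (use w in \<open>simp_all add: ev_monomial Z_coords_iff\<close>)
  also have "\<dots> = (if a = (\<alpha>, j) then \<Prod>i\<in>UNIV. fact (\<alpha> i) else 0)"
  proof (cases "snd a = j")
    case True
    then have "(\<lambda>z. axis j (normal_monomial \<alpha> z) $ snd a) = normal_monomial \<alpha>"
      by (auto simp: axis_def)
    then show ?thesis
      using multi_partial_normal_monomial[of "Z_embed w" "fst a" \<alpha>] True
      by (auto simp: prod_eq_iff)
  next
    case False
    then have eq: "(\<lambda>z. axis j (normal_monomial \<alpha> z) $ snd a) = (\<lambda>_. 0)"
      by (auto simp: axis_def)
    show ?thesis unfolding eq multi_partial_const using False by auto
  qed
  finally show ?thesis .
qed

definition dual_monomial :: "('d \<Rightarrow> nat) \<times> 'r \<Rightarrow> 'h" where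
  "dual_monomial a = (1 / (\<Prod>i\<in>UNIV. fact (fst a i))) *\<^sub>C monomial (fst a) (snd a)"

lemma jet_dual_monomial:
  assumes "w \<in> Z_coords \<Omega>"
  shows "jet w a (dual_monomial b) = (if a = b then 1 else 0)"
  using assms by (auto simp: dual_monomial_def jet_scaleC jet_monomial)

text \<open>The orthogonal complement of this space is the joint eigenspace of the adjoints \<open>M\<^sub>l\<^sup>*\<close> of the
  tangential multiplications at the conjugate of \<open>w\<close>.\<close>
definition tangential_range :: "complex ^ 'e \<Rightarrow> 'h set" where
  "tangential_range w = range (\<lambda>u. \<Sum>l\<in>UNIV. M (Inr l) (u l) - w $ l *\<^sub>C u l)"

lemma tangential_rangeI:
  "x = (\<Sum>l\<in>UNIV. M (Inr l) (u l) - w $ l *\<^sub>C u l) \<Longrightarrow> x \<in> tangential_range w"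
  by (simp add: tangential_range_def)

lemma subspace_tangential_range: "complex_vector.subspace (tangential_range w)"
  unfolding complex_vector.subspace_def
proof (intro conjI ballI allI)
  show "0 \<in> tangential_range w"
    unfolding tangential_range_def
    by (rule range_eqI[of _ _ "\<lambda>_. 0"]) (simp add: M_diff[of _ 0 0, simplified])
next
  fix x y assume "x \<in> tangential_range w" "y \<in> tangential_range w"
  then obtain u v where "x = (\<Sum>l\<in>UNIV. M (Inr l) (u l) - w $ l *\<^sub>C u l)"
    "y = (\<Sum>l\<in>UNIV. M (Inr l) (v l) - w $ l *\<^sub>C v l)"
    by (auto simp: tangential_range_def)
  then have "x + y = (\<Sum>l\<in>UNIV. M (Inr l) (u l + v l) - w $ l *\<^sub>C (u l + v l))"
    by (simp add: M_add scaleC_add_right add_diff_add sum.distrib)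
  then show "x + y \<in> tangential_range w" by (rule tangential_rangeI)
next
  fix c x assume "x \<in> tangential_range w"
  then obtain u where "x = (\<Sum>l\<in>UNIV. M (Inr l) (u l) - w $ l *\<^sub>C u l)"
    by (auto simp: tangential_range_def)
  then have "c *\<^sub>C x = (\<Sum>l\<in>UNIV. M (Inr l) (c *\<^sub>C u l) - w $ l *\<^sub>C (c *\<^sub>C u l))"
    by (simp add: M_scaleC complex_vector.scale_sum_right complex_vector.scale_right_diff_distrib mult.commute
        scaleC_scaleC)
  then show "c *\<^sub>C x \<in> tangential_range w" by (rule tangential_rangeI)
qed

lemma M_tangential_range:
  assumes "x \<in> tangential_range w"
  shows "M i x \<in> tangential_range w"
proof -
  obtain u where "x = (\<Sum>l\<in>UNIV. M (Inr l) (u l) - w $ l *\<^sub>C u l)"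
    using assms by (auto simp: tangential_range_def)
  then have "M i x = (\<Sum>l\<in>UNIV. M (Inr l) (M i (u l)) - w $ l *\<^sub>C M i (u l))"
    by (simp add: M_sum M_diff M_scaleC M_commute[of i])
  then show ?thesis by (rule tangential_rangeI)
qed

text \<open>A Taylor expansion of order \<open>k\<close> in the normal directions, with remainder vanishing to order \<open>k\<close>
  along the subvariety, modulo the tangential range. By Gleason, subtracting the value of \<open>h\<close> at the
  point leaves \<open>\<Sum>\<^sub>i z\<^sub>i u\<^sub>i\<close> plus a tangential term; expanding each \<open>u\<^sub>i\<close> to order \<open>k\<close> and multiplying by
  \<open>z\<^sub>i\<close> raises the degree of the monomials and the order of vanishing by one.\<close>
lemma Taylor_decomposition:
  assumes w: "w \<in> Z_coords \<Omega>"
  shows "h \<in> complex_vector.span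
    ({monomial \<alpha> j | \<alpha> j. \<alpha> \<in> A_indices k} \<union> (submodule_M0 \<Omega> k ev \<union> tangential_range w))"
proof (induction k arbitrary: h)
  case 0
  have "submodule_M0 \<Omega> 0 ev = UNIV" by (simp add: submodule_M0_def A_indices_def)
  then show ?case by (intro complex_vector.span_base) auto
next
  case (Suc k)
  let ?G = "\<lambda>k. {monomial \<alpha> j | \<alpha> j. \<alpha> \<in> A_indices k} \<union> (submodule_M0 \<Omega> k ev \<union> tangential_range w)"
  have step: "M (Inl i) x \<in> complex_vector.span (?G (Suc k))" for i x
  proof -
    have "M (Inl i) x \<in> complex_vector.span (?G (Suc k))" if "x \<in> complex_vector.span (?G k)" for x
      using that
    proof (induction rule: complex_vector.span_induct)
      case base
      show ?case
        by (auto simp: complex_vector.subspace_def M_add M_scaleC M_diff[of _ 0 0, simplified]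
            intro: complex_vector.span_add complex_vector.span_scale complex_vector.span_zero)
    next
      case (step y)
      then consider \<alpha> j where "\<alpha> \<in> A_indices k" "y = monomial \<alpha> j" | "y \<in> submodule_M0 \<Omega> k ev"
        | "y \<in> tangential_range w" by blast
      then have "M (Inl i) y \<in> ?G (Suc k)"
      proof cases
        case 1
        have "sum \<alpha> (UNIV - {i}) = sum (\<alpha>(i := \<alpha> i + 1)) (UNIV - {i})" by (rule sum.cong) auto
        then have "sum (\<alpha>(i := \<alpha> i + 1)) UNIV = Suc (sum \<alpha> UNIV)"
          by (simp add: sum.remove[of UNIV i])
        then have "\<alpha>(i := \<alpha> i + 1) \<in> A_indices (Suc k)" using 1 by (simp add: A_indices_def)
        then show ?thesis using 1 by (auto simp: M_Inl_monomial)
      qed (auto intro: M_Inl_submodule_M0 M_tangential_range)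
      then show ?case by (rule complex_vector.span_base)
    qed
    then show ?thesis using Suc.IH by blast
  qed
  define p where "p = (\<Sum>j\<in>UNIV. (ev h (Z_embed w) $ j) *\<^sub>C monomial (\<lambda>_. 0) j)"
  have p: "p \<in> complex_vector.span (?G (Suc k))"
    unfolding p_def
    by (intro complex_vector.span_sum complex_vector.span_scale complex_vector.span_base)
      (auto simp: A_indices_def)
  have wD: "Z_embed w \<in> \<Omega>" using w by (simp add: Z_coords_iff)
  have "ev p (Z_embed w) = ev h (Z_embed w)"
    by (simp add: p_def ev_sum ev_scaleC ev_monomial wD vec_eq_iff normal_monomial_def axis_def if_distrib cong: if_cong)
  then have "ev (h - p) (Z_embed w) = 0" by (simp add: ev_diff wD)
  then obtain u where u: "\<And>z. z \<in> \<Omega> \<Longrightarrow>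
      ev (h - p) z = (\<Sum>i\<in>UNIV. (z $ i - Z_embed w $ i) *s ev (u i) z)"
    using gleason wD unfolding gleason_property_def by blast
  have "h - p = (\<Sum>i\<in>UNIV. M i (u i) - Z_embed w $ i *\<^sub>C u i)"
    by (rule ev_eqI, simp only: u)
      (simp add: ev_sum ev_diff ev_M ev_scaleC vector_sub_rdistrib)
  also have "\<dots> = (\<Sum>i\<in>UNIV. M (Inl i) (u (Inl i)))
      + (\<Sum>l\<in>UNIV. M (Inr l) (u (Inr l)) - w $ l *\<^sub>C u (Inr l))"
    by (simp add: sum_over_sum_type)
  also have "\<dots> \<in> complex_vector.span (?G (Suc k))"
    by (intro complex_vector.span_add complex_vector.span_sum step complex_vector.span_base)
      (auto simp: tangential_range_def)
  finally show ?case
    using complex_vector.span_add[OF _ p] by fastforce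
qed

text \<open>In the Taylor decomposition the remainder and the tangential term have zero jet at the point.
  If \<open>h\<close> has zero jet as well, then so has the polynomial part, and a polynomial part is determined
  by its jet.\<close>
lemma vanishing_jet_decomposition:
  assumes w: "w \<in> Z_coords \<Omega>" and h: "\<forall>a\<in>A_indices k \<times> UNIV. jet w a h = 0"
  shows "\<exists>g\<in>submodule_M0 \<Omega> k ev. \<exists>u. h = g + (\<Sum>l\<in>UNIV. M (Inr l) (u l) - w $ l *\<^sub>C u l)"
proof -
  let ?I = "A_indices k \<times> UNIV :: (('d \<Rightarrow> nat) \<times> 'r) set"
  have fin: "finite ?I" by (simp add: finite_A_indices)
  obtain p s where p: "p \<in> complex_vector.span {monomial \<alpha> j | \<alpha> j. \<alpha> \<in> A_indices k}"
    and s: "s \<in> complex_vector.span (submodule_M0 \<Omega> k ev \<union> tangential_range w)"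
    and hps: "h = p + s"
    using Taylor_decomposition[OF w, of h k] unfolding complex_vector.span_Un by blast
  have span_id: "complex_vector.span (submodule_M0 \<Omega> k ev) = submodule_M0 \<Omega> k ev"
    "complex_vector.span (tangential_range w) = tangential_range w"
    by (simp_all only: complex_vector.span_eq_iff subspace_submodule_M0 subspace_tangential_range)
  obtain g r where g: "g \<in> submodule_M0 \<Omega> k ev" and r: "r \<in> tangential_range w" and "s = g + r"
    using s unfolding complex_vector.span_Un span_id by blast
  obtain u where u: "r = (\<Sum>l\<in>UNIV. M (Inr l) (u l) - w $ l *\<^sub>C u l)"
    using r by (auto simp: tangential_range_def)
  have jr: "jet w a r = 0" for a
  proof -
    have lin: "linear (jet w a)" by (rule bounded_linear.linear[OF bounded_linear_jet[OF w]])
    show ?thesis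
      by (simp add: u linear_sum[OF lin] linear_diff[OF lin] jet_M_Inr jet_scaleC w)
  qed
  \<comment> \<open>A linear map that fixes the monomials of order below \<open>k\<close>, hence the polynomial part.\<close>
  define E where "E x = (\<Sum>a\<in>?I. jet w a x *\<^sub>C dual_monomial a)" for x
  have "E p = p"
    using p
  proof (induction rule: complex_vector.span_induct)
    case base
    have E0: "E 0 = 0" by (simp add: E_def jet_zero w)
    have Eadd: "E (x + y) = E x + E y" for x y
      by (simp add: E_def jet_add w scaleC_add_left sum.distrib)
    have Escale: "E (c *\<^sub>C x) = c *\<^sub>C E x" for c x
      by (simp add: E_def jet_scaleC w complex_vector.scale_sum_right scaleC_scaleC)
    show ?case by (simp add: complex_vector.subspace_def E0 Eadd Escale)
  next
    case (step x)
    then obtain \<alpha> j where \<alpha>: "\<alpha> \<in> A_indices k" "x = monomial \<alpha> j" by blast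
    have "E x = (\<Sum>a\<in>?I. if a = (\<alpha>, j) then (\<Prod>i\<in>UNIV. fact (\<alpha> i)) *\<^sub>C dual_monomial (\<alpha>, j) else 0)"
      unfolding E_def by (intro sum.cong) (auto simp: \<alpha> jet_monomial w)
    also have "\<dots> = (\<Prod>i\<in>UNIV. fact (\<alpha> i)) *\<^sub>C dual_monomial (\<alpha>, j)"
      using \<alpha> fin by simp
    also have "\<dots> = x" by (simp add: dual_monomial_def scaleC_scaleC \<alpha>)
    finally show ?case .
  qed
  have "jet w a p = 0" if "a \<in> ?I" for a
  proof -
    have "jet w a h = jet w a p + (jet w a g + jet w a r)"
      by (simp add: hps \<open>s = g + r\<close> jet_add w)
    moreover have "jet w a g = 0" using g w that by (auto simp: submodule_M0_eq_jets)
    ultimately show ?thesis using h that jr by simp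
  qed
  then have "E p = 0" unfolding E_def by (intro sum.neutral) simp
  then have "p = 0" using \<open>E p = p\<close> by simp
  then show ?thesis using g u hps \<open>s = g + r\<close> by auto
qed

lemma quotient_in_B: "quotient_in_B (card (A_indices k :: ('d \<Rightarrow> nat) set) * CARD('r)) \<Omega> k ev"
proof -
  have "operator_class_B (card (A_indices k \<times> UNIV :: (('d \<Rightarrow> nat) \<times> 'r) set))
      (conj_set (Z_coords \<Omega>)) (orth_compl (submodule_M0 \<Omega> k ev))
      (\<lambda>j. adjoint_on (orth_compl (submodule_M0 \<Omega> k ev))
             (\<lambda>h. orth_proj (orth_compl (submodule_M0 \<Omega> k ev)) (M (Inr j) h)))"
  proof (rule quotient_tuple_in_class_B[where \<phi> = jet and e = "\<lambda>_. dual_monomial"])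
    show "open (Z_coords \<Omega>)" by (rule open_Z_coords[OF open_domain])
    show "finite (A_indices k \<times> UNIV :: (('d \<Rightarrow> nat) \<times> 'r) set)"
      by (simp add: finite_A_indices)
    show "submodule_M0 \<Omega> k ev = {h. \<forall>w\<in>Z_coords \<Omega>. \<forall>a\<in>A_indices k \<times> UNIV. jet w a h = 0}"
      by (rule submodule_M0_eq_jets)
  qed (intro bounded_linear_M M_scaleC M_commute bounded_linear_jet jet_scaleC jet_M_Inr
      jet_dual_monomial vanishing_jet_decomposition; assumption)+
  then show ?thesis
    by (simp add: quotient_in_B_def quotient_Mq_def card_cartesian_product)
qed

end

theorem theorem4p8:
  fixes \<Omega> :: "(complex ^ ('d::{finite,linorder} + 'e::finite)) set"
    and ev :: "'h::complex_hilbert \<Rightarrow> complex ^ ('d + 'e) \<Rightarrow> complex ^ 'r::finite"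
    and k :: nat
  assumes "open \<Omega>" and "connected \<Omega>" and "bounded \<Omega>" and "0 \<in> \<Omega>"
    and "rk_hilbert_module \<Omega> ev"
    and "contains_polynomials \<Omega> ev"
    and "\<forall>z\<in>\<Omega>. surj (\<lambda>h. ev h z)"
    and "gleason_property \<Omega> ev"
    and "k \<ge> 1"
    and "module_in_B CARD('r) \<Omega> ev"
  shows "quotient_in_B (card (A_indices k :: ('d \<Rightarrow> nat) set) * CARD('r)) \<Omega> k ev"
proof -
  interpret gleason_module \<Omega> ev
    by (rule gleason_module.intro) (use assms in auto)
  show ?thesis by (rule quotient_in_B)
qed

end
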